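(* Let $V$ be a finite set with $|V|=\ell\geq 2$, let $\bm{n}\in\mathbb{Z}_{\geq 0}^{V}$, and let $G=(V,\emptyset)$ be the digraph with no edges. Then the cone $c\mathscr{A}(\bm{n},G)$ is free with exponents $\{0,1,|\bm{n}|+1,|\bm{n}|+2,\dots,|\bm{n}|+\ell-1\}$. In particular, $c\mathscr{A}(\bm{n},G)$ is inductively free.
   Context: $\mathbb{K}$ is a field of characteristic zero; $|\bm{n}|:=\sum_{i\in V}n_i$. For a digraph $G=(V,E)$ ($E\subseteq\{(i,j)\mid i\neq j\}$) let $\varepsilon_G(i,j)=1$ if $(i,j)\in E$, else $0$. $\mathscr{A}(\bm{n},G)$ is the arrangement in $\mathbb{K}^V$ of hyperplanes $\{x_i-x_j=c\}$, $i\neq j$, $c\in\mathbb{Z}$, $-n_i-\varepsilon_G(i,j)\leq c\leq n_j+\varepsilon_G(j,i)$. Its cone $c\mathscr{A}(\bm{n},G)$ is the central arrangement in $\mathbb{K}^{V}\times\mathbb{K}$ (coordinates $x_i$, $z$) consisting of $\{z=0\}$ and the hyperplanes $\{x_i-x_j=cz\}$ for each $\{x_i-x_j=c\}\in\mathscr{A}(\bm{n},G)$. A central arrangement $\mathscr{A}$ in $\mathbb{K}^N$ with polynomial ring $S=\mathbb{K}[y_1,\dots,y_N]$ is free if $D(\mathscr{A})=\{\theta\in\bigoplus_k S\partial_k\mid \theta(\alpha_H)\in\alpha_H S\ \forall H\in\mathscr{A}\}$ ($\alpha_H$ a linear form defining $H$) is a free $S$-module; its exponents are the multiset of degrees of a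 homogeneous basis. The restriction to $H\in\mathscr{A}$ is $\mathscr{A}^H=\{H'\cap H\mid H'\in\mathscr{A}\setminus\{H\}\}$. The class of inductively free arrangements is the smallest class of central arrangements containing the empty arrangements and such that if there is $H\in\mathscr{A}$ with $\mathscr{A}\setminus\{H\}$ and $\mathscr{A}^H$ in the class and $\exp(\mathscr{A}^H)\subseteq\exp(\mathscr{A}\setminus\{H\})$ (as multisets), then $\mathscr{A}$ is in the class. *)

theory Defs
  imports Complex_Main "HOL-Library.Poly_Mapping" "HOL-Library.Multiset"
begin

section \<open>Coordinate spaces and polynomial rings\<close>

text \<open>
  For a finite index set \<open>I\<close>, the space \<open>K\<^sup>I\<close> is the set of all functions vanishing
  outside \<open>I\<close>. Index sets (rather than index types) are needed because the
  dimension drops when an arrangement is restricted to one of its hyperplanes.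
\<close>

definition coord_space :: "'i set \<Rightarrow> ('i \<Rightarrow> 'k::field) set" where
  "coord_space I = {x. \<forall>i. i \<notin> I \<longrightarrow> x i = 0}"

text \<open>
  A polynomial maps each monomial (an exponent vector) to its coefficient;
  \<open>polys I\<close> is the polynomial ring in the variables indexed by \<open>I\<close>.
\<close>

type_synonym ('i, 'k) mpoly = "('i \<Rightarrow>\<^sub>0 nat) \<Rightarrow>\<^sub>0 'k"

definition polys :: "'i set \<Rightarrow> ('i, 'k::field) mpoly set" where
  "polys I = {p. \<forall>m \<in> Poly_Mapping.keys p. Poly_Mapping.keys m \<subseteq> I}"

definition homogeneous :: "nat \<Rightarrow> ('i, 'k::field) mpoly \<Rightarrow> bool" where
  "homogeneous d p \<longleftrightarrow> (\<forall>m \<in> Poly_Mapping.keys p. (\<Sum>i\<in>Poly_Mapping.keys m. Poly_Mapping.lookup m i) = d)"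

definition pdiff :: "'i \<Rightarrow> ('i, 'k::field) mpoly \<Rightarrow> ('i, 'k) mpoly" where
  "pdiff k p =
    (\<Sum>m\<in>Poly_Mapping.keys p. Poly_Mapping.single (m - Poly_Mapping.single k 1) (of_nat (Poly_Mapping.lookup m k) * Poly_Mapping.lookup p m))"

definition lin_form :: "'i set \<Rightarrow> ('i \<Rightarrow> 'k::field) \<Rightarrow> ('i, 'k) mpoly" where
  "lin_form I a = (\<Sum>i\<in>I. Poly_Mapping.single (Poly_Mapping.single i 1) (a i))"

lemma pdiff_lin_form:
  assumes "finite I" "k \<in> I"
  shows "pdiff k (lin_form I a) = Poly_Mapping.single 0 (a k)"
proof -
  let ?e = "\<lambda>i. Poly_Mapping.single i (1::nat)"
  have inj: "?e i = ?e j \<longleftrightarrow> i = j" for i j :: 'a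
    by (metis lookup_single_eq lookup_single_not_eq one_neq_zero)
  have lk: "Poly_Mapping.lookup (lin_form I a) (?e i) = (if i \<in> I then a i else 0)" for i
    using assms(1) unfolding lin_form_def lookup_sum
    by (simp add: lookup_single when_def inj[simplified])
  have sub: "Poly_Mapping.keys (lin_form I a) \<subseteq> ?e ` I"
  proof
    fix m assume "m \<in> Poly_Mapping.keys (lin_form I a)"
    then have "(\<Sum>i\<in>I. Poly_Mapping.lookup (Poly_Mapping.single (?e i) (a i)) m) \<noteq> 0"
      by (simp add: in_keys_iff lin_form_def lookup_sum)
    then obtain i where "i \<in> I" "Poly_Mapping.lookup (Poly_Mapping.single (?e i) (a i)) m \<noteq> 0"
      by (meson sum.not_neutral_contains_not_neutral)
    then show "m \<in> ?e ` I"
      by (auto simp: lookup_single when_def split: if_splits)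
  qed
  let ?g = "\<lambda>m. Poly_Mapping.single (m - ?e k)
                 (of_nat (Poly_Mapping.lookup m k) * Poly_Mapping.lookup (lin_form I a) m)"
  have "pdiff k (lin_form I a) = (\<Sum>m\<in>?e ` I. ?g m)"
    unfolding pdiff_def using assms(1) sub
    by (intro sum.mono_neutral_left) (auto simp: in_keys_iff)
  also have "\<dots> = (\<Sum>i\<in>I. ?g (?e i))"
    by (subst sum.reindex) (auto simp: inj_on_def inj[simplified])
  also have "\<dots> = (\<Sum>i\<in>I. if i = k then Poly_Mapping.single 0 (a k) else 0)"
    using assms(2) by (intro sum.cong refl) (auto simp: lk[simplified] lookup_single)
  also have "\<dots> = Poly_Mapping.single 0 (a k)"
    using assms by simp
  finally show ?thesis .
qed


section \<open>Central arrangements, derivations and freeness\<close>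

definition hyperplane_of :: "'i set \<Rightarrow> ('i \<Rightarrow> 'k::field) \<Rightarrow> ('i \<Rightarrow> 'k) set" where
  "hyperplane_of I a = {x \<in> coord_space I. (\<Sum>i\<in>I. a i * x i) = 0}"

definition defining_form :: "'i set \<Rightarrow> ('i \<Rightarrow> 'k::field) \<Rightarrow> ('i \<Rightarrow> 'k) set \<Rightarrow> bool" where
  "defining_form I a H \<longleftrightarrow> a \<in> coord_space I \<and> (\<exists>i\<in>I. a i \<noteq> 0) \<and> H = hyperplane_of I a"

definition central_arrangement :: "'i set \<Rightarrow> ('i \<Rightarrow> 'k::field) set set \<Rightarrow> bool" where
  "central_arrangement I A \<longleftrightarrow> finite I \<and> finite A \<and> (\<forall>H\<in>A. \<exists>a. defining_form I a H)"

text \<open>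
  A derivation \<open>\<Sum>\<^sub>k \<theta>\<^sub>k \<partial>\<^sub>k\<close> is represented by its family of coefficients \<open>\<theta>\<^sub>k\<close>,
  extended by \<open>0\<close> outside the index set.
\<close>

definition derivations :: "'i set \<Rightarrow> ('i \<Rightarrow> ('i, 'k::field) mpoly) set" where
  "derivations I = {\<theta>. (\<forall>k\<in>I. \<theta> k \<in> polys I) \<and> (\<forall>k. k \<notin> I \<longrightarrow> \<theta> k = 0)}"

definition apply_derivation ::
    "'i set \<Rightarrow> ('i \<Rightarrow> ('i, 'k::field) mpoly) \<Rightarrow> ('i, 'k) mpoly \<Rightarrow> ('i, 'k) mpoly" where
  "apply_derivation I \<theta> f = (\<Sum>k\<in>I. \<theta> k * pdiff k f)"

definition log_derivations ::
    "'i set \<Rightarrow> ('i \<Rightarrow> 'k::field) set set \<Rightarrow> ('i \<Rightarrow> ('i, 'k) mpoly) set" where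
  "log_derivations I A = {\<theta> \<in> derivations I. \<forall>H\<in>A. \<forall>a. defining_form I a H \<longrightarrow>
      (\<exists>q \<in> polys I. apply_derivation I \<theta> (lin_form I a) = lin_form I a * q)}"

text \<open>
  Bases over \<open>polys I\<close>. Only finite bases are considered: the module of logarithmic
  derivations is finitely generated, so all its bases are finite.
\<close>

definition module_basis ::
    "'i set \<Rightarrow> ('i \<Rightarrow> ('i, 'k::field) mpoly) set \<Rightarrow> ('i \<Rightarrow> ('i, 'k) mpoly) set \<Rightarrow> bool" where
  "module_basis I M B \<longleftrightarrow> finite B \<and> B \<subseteq> M \<and>
     (\<forall>\<delta>\<in>M. \<exists>c. (\<forall>\<theta>\<in>B. c \<theta> \<in> polys I) \<and> (\<forall>k. \<delta> k = (\<Sum>\<theta>\<in>B. c \<theta> * \<theta> k))) \<and>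
     (\<forall>c. (\<forall>\<theta>\<in>B. c \<theta> \<in> polys I) \<and> (\<forall>k. (\<Sum>\<theta>\<in>B. c \<theta> * \<theta> k) = 0) \<longrightarrow> (\<forall>\<theta>\<in>B. c \<theta> = 0))"

definition free_arrangement :: "'i set \<Rightarrow> ('i \<Rightarrow> 'k::field) set set \<Rightarrow> bool" where
  "free_arrangement I A \<longleftrightarrow>
     central_arrangement I A \<and> (\<exists>B. module_basis I (log_derivations I A) B)"

text \<open>
  \<open>has_exponents I A E\<close>: the degrees of some homogeneous basis form the multiset \<open>E\<close>.
  The degree of a derivation is the polynomial degree of its coefficients; it is
  unambiguous for basis elements, since these are nonzero.
\<close>

definition has_exponents :: "'i set \<Rightarrow> ('i \<Rightarrow> 'k::field) set set \<Rightarrow> nat multiset \<Rightarrow> bool" where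
  "has_exponents I A E \<longleftrightarrow> central_arrangement I A \<and>
     (\<exists>B d. module_basis I (log_derivations I A) B \<and>
        (\<forall>\<theta>\<in>B. \<forall>k\<in>I. homogeneous (d \<theta>) (\<theta> k)) \<and>
        E = image_mset d (mset_set B))"


section \<open>Restriction and inductive freeness\<close>

definition restriction :: "('i \<Rightarrow> 'k::field) set set \<Rightarrow> ('i \<Rightarrow> 'k) set \<Rightarrow> ('i \<Rightarrow> 'k) set set" where
  "restriction A H = (\<lambda>H'. H' \<inter> H) ` (A - {H})"

text \<open>
  The restriction is an arrangement in the vector space \<open>H\<close>. It is turned into an
  arrangement in a coordinate space by a linear isomorphism \<open>\<phi>\<close> from \<open>K\<^sup>J\<close> onto \<open>H\<close>
  (so that \<open>J\<close> has one element less than \<open>I\<close>). Freeness, exponents and inductive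
  freeness do not depend on the choice of \<open>\<phi>\<close>.
\<close>

definition linear_coordinates ::
    "'i set \<Rightarrow> (('i \<Rightarrow> 'k::field) \<Rightarrow> ('i \<Rightarrow> 'k)) \<Rightarrow> ('i \<Rightarrow> 'k) set \<Rightarrow> bool" where
  "linear_coordinates J \<phi> H \<longleftrightarrow> finite J \<and> bij_betw \<phi> (coord_space J) H \<and>
     (\<forall>x\<in>coord_space J. \<forall>y\<in>coord_space J. \<phi> (\<lambda>i. x i + y i) = (\<lambda>i. \<phi> x i + \<phi> y i)) \<and>
     (\<forall>c. \<forall>x\<in>coord_space J. \<phi> (\<lambda>i. c * x i) = (\<lambda>i. c * \<phi> x i))"

definition pullback ::
    "'i set \<Rightarrow> (('i \<Rightarrow> 'k::field) \<Rightarrow> ('i \<Rightarrow> 'k)) \<Rightarrow> ('i \<Rightarrow> 'k) set set \<Rightarrow> ('i \<Rightarrow> 'k) set set" where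
  "pullback J \<phi> A = (\<lambda>X. {x \<in> coord_space J. \<phi> x \<in> X}) ` A"

inductive inductively_free :: "'i set \<Rightarrow> ('i \<Rightarrow> 'k::field) set set \<Rightarrow> bool" where
  empty: "finite I \<Longrightarrow> inductively_free I {}"
| add: "\<lbrakk>central_arrangement I A; H \<in> A; inductively_free I (A - {H});
         linear_coordinates J \<phi> H; inductively_free J (pullback J \<phi> (restriction A H));
         has_exponents J (pullback J \<phi> (restriction A H)) E';
         has_exponents I (A - {H}) E; E' \<subseteq># E\<rbrakk>
        \<Longrightarrow> inductively_free I A"


section \<open>The arrangement of a digraph and its cone\<close>

text \<open>A digraph is given by its vertex set \<open>V\<close> and its edge set \<open>E\<close>.\<close>

definition edge_ind :: "('v \<times> 'v) set \<Rightarrow> 'v \<Rightarrow> 'v \<Rightarrow> int" where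
  "edge_ind E i j = (if (i, j) \<in> E then 1 else 0)"

definition affine_hyp :: "'v set \<Rightarrow> 'v \<Rightarrow> 'v \<Rightarrow> int \<Rightarrow> ('v \<Rightarrow> 'k::field) set" where
  "affine_hyp V i j c = {x \<in> coord_space V. x i - x j = of_int c}"

definition digraph_arrangement ::
    "'v set \<Rightarrow> ('v \<times> 'v) set \<Rightarrow> ('v \<Rightarrow> nat) \<Rightarrow> ('v \<Rightarrow> 'k::field) set set" where
  "digraph_arrangement V E n = {affine_hyp V i j c | i j c. i \<in> V \<and> j \<in> V \<and> i \<noteq> j \<and>
      - int (n i) - edge_ind E i j \<le> c \<and> c \<le> int (n j) + edge_ind E j i}"

text \<open>
  The space \<open>K\<^sup>V \<times> K\<close> of the cone is encoded as the coordinate space with index set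
  \<open>cone_index V\<close>, where \<open>Some i\<close> indexes the coordinate \<open>x\<^sub>i\<close> and \<open>None\<close> the coordinate \<open>z\<close>.
\<close>

definition cone_index :: "'v set \<Rightarrow> 'v option set" where
  "cone_index V = insert None (Some ` V)"

definition hyp_at_infinity :: "'v set \<Rightarrow> ('v option \<Rightarrow> 'k::field) set" where
  "hyp_at_infinity V = {y \<in> coord_space (cone_index V). y None = 0}"

definition cone_hyp :: "'v set \<Rightarrow> 'v \<Rightarrow> 'v \<Rightarrow> int \<Rightarrow> ('v option \<Rightarrow> 'k::field) set" where
  "cone_hyp V i j c =
     {y \<in> coord_space (cone_index V). y (Some i) - y (Some j) = of_int c * y None}"

definition cone_arrangement ::
    "'v set \<Rightarrow> ('v \<times> 'v) set \<Rightarrow> ('v \<Rightarrow> nat) \<Rightarrow> ('v option \<Rightarrow> 'k::field) set set" where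
  "cone_arrangement V E n = insert (hyp_at_infinity V)
     {cone_hyp V i j c | i j c. i \<in> V \<and> j \<in> V \<and> i \<noteq> j \<and>
        (affine_hyp V i j c :: ('v \<Rightarrow> 'k) set) \<in> digraph_arrangement V E n}"

end

theory Submission
  imports Defs "HOL-Computational_Algebra.Factorial_Ring"
begin

text \<open>
  A vertex \<open>i\<close> stands for the interval \<open>[x\<^sub>i, x\<^sub>i + n\<^sub>i z]\<close>, and the hyperplanes of the arrangement say
  that two intervals meet. To raise \<open>n\<^sub>v\<close> from \<open>m - 1\<close> to \<open>m\<close>, add the hyperplanes \<open>x\<^sub>i = x\<^sub>v + m z\<close> one at
  a time. Whichever of them are already present, restricting to the next one glues the interval of
  \<open>i\<close> to that of \<open>v\<close> and gives the arrangement on \<open>V - {i}\<close> in which \<open>v\<close> has parameter \<open>n\<^sub>i + m\<close>. So all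
  these restrictions have the same exponents, and each addition raises one remaining exponent by
  one. Induction on the number of vertices and on \<open>|n|\<close> (with \<open>m = 0\<close> introducing a new vertex when
  all parameters vanish) reduces everything to Terao's addition theorem.
\<close>

subsection \<open>Polynomials\<close>

text \<open>Let N be the total of the parameters after a raise and w + 1 the number of active
  vertices. Apart from the zeros of inactive vertices, the exponents before the raise are 0, 1, N,
  ..., N + w - 1. Each restriction has w active vertices and the same total N, hence exponents 0, 1,
  N + 1, ..., N + w - 1. So the surplus exponent is N, and w additions turn it into N + w. The rule
  \<open>add\<close> speaks of the exponents of the smaller arrangement and of the restriction.
  Those of the enlarged one, which the next addition needs, come from Terao's theorem, proved here
  by an explicit change of homogeneous basis. Its degree |A| - |A^H| is identified with the surplus
  by comparing sums of exponents. A vertex still to be introduced behaves like one of parameter -1: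
  its coordinate is present, but no hyperplane involves it. The induction therefore ranges over a
  set \<open>W\<close> of active vertices inside \<open>V\<close>, and each inactive vertex
  contributes an exponent 0.\<close>

definition cst :: "'k \<Rightarrow> ('i, 'k::field) mpoly" where
  "cst c = Poly_Mapping.single 0 c"

definition var :: "'i \<Rightarrow> ('i, 'k::field) mpoly" where
  "var i = Poly_Mapping.single (Poly_Mapping.single i 1) 1"

lemma cst_0 [simp]: "cst 0 = 0"
  and cst_1 [simp]: "cst 1 = 1"
  and cst_add: "cst (a + b) = cst a + cst b"
  and cst_mult: "cst (a * b) = cst a * cst b"
  and cst_uminus: "cst (- a) = - cst a"
  and cst_diff: "cst (a - b) = cst a - cst b"
  by (simp_all add: cst_def single_add single_uminus single_diff mult_single)

lemma cst_eq_iff [simp]: "cst a = cst b \<longleftrightarrow> a = b"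
  by (metis cst_def lookup_single_eq)

lemma cst_eq_0_iff [simp]: "cst a = 0 \<longleftrightarrow> a = 0"
  by (metis cst_0 cst_eq_iff)

lemma cst_inverse_mult: "c \<noteq> 0 \<Longrightarrow> cst (inverse c) * (cst c * p) = p"
  by (metis cst_1 cst_mult left_inverse mult.assoc mult_1)

lemma lin_form_eq: "lin_form I a = (\<Sum>i\<in>I. cst (a i) * var i)"
  by (simp add: lin_form_def cst_def var_def mult_single)

lemma keys_var [simp]: "Poly_Mapping.keys (var i :: ('i, 'k::field) mpoly) = {Poly_Mapping.single i 1}"
  by (simp add: var_def)

lemma poly_mapping_expand:
  "p = (\<Sum>m\<in>Poly_Mapping.keys p. Poly_Mapping.single m (Poly_Mapping.lookup p m))"
  by (rule poly_mapping_eqI) (auto simp: lookup_sum lookup_single when_def not_in_keys_iff_lookup_eq_zero)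

lemma single_monomial_induct:
  assumes "Poly_Mapping.keys m \<subseteq> I"
    and "\<And>c. P (cst c)"
    and "\<And>i p. i \<in> I \<Longrightarrow> P p \<Longrightarrow> P (var i * p)"
  shows "P (Poly_Mapping.single m c :: ('i, 'k::field) mpoly)"
  using assms(1)
proof (induction "\<Sum>i\<in>Poly_Mapping.keys m. Poly_Mapping.lookup m i" arbitrary: m rule: less_induct)
  case less
  show ?case
  proof (cases "m = 0")
    case True
    then show ?thesis using assms(2)[of c] by (simp add: cst_def)
  next
    case False
    then obtain i where i: "i \<in> Poly_Mapping.keys m"
      using keys_eq_empty by blast
    define m' where "m' = m - Poly_Mapping.single i 1"
    have m: "m = Poly_Mapping.single i 1 + m'"
      using i unfolding m'_def
      by (intro poly_mapping_eqI)
        (auto simp: lookup_add lookup_minus lookup_single when_def in_keys_iff)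
    have sub: "Poly_Mapping.keys m' \<subseteq> Poly_Mapping.keys m"
      unfolding m'_def by (auto simp: in_keys_iff lookup_minus)
    have "(\<Sum>j\<in>Poly_Mapping.keys m'. Poly_Mapping.lookup m' j) = (\<Sum>j\<in>Poly_Mapping.keys m. Poly_Mapping.lookup m' j)"
      using sub by (intro sum.mono_neutral_left) (auto simp: in_keys_iff)
    also have "\<dots> < (\<Sum>j\<in>Poly_Mapping.keys m. Poly_Mapping.lookup m j)"
      using i by (intro sum_strict_mono_ex1)
        (auto simp: m'_def lookup_minus lookup_single when_def in_keys_iff intro!: bexI[of _ i])
    finally have "P (Poly_Mapping.single m' c)"
      using less sub by blast
    then have "P (var i * Poly_Mapping.single m' c)"
      using assms(3) i less.prems by blast
    then show ?thesis
      by (subst m) (simp add: var_def mult_single)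
  qed
qed

lemma cst_in_polys [simp]: "cst c \<in> polys I"
  by (simp add: polys_def cst_def)

lemma zero_in_polys [simp]: "0 \<in> polys I"
  by (simp add: polys_def)

lemma one_in_polys [simp]: "1 \<in> polys I"
  by (simp add: polys_def)

lemma var_in_polys [simp]: "i \<in> I \<Longrightarrow> var i \<in> polys I"
  by (simp add: polys_def)

lemma add_in_polys: "p \<in> polys I \<Longrightarrow> q \<in> polys I \<Longrightarrow> p + q \<in> polys I"
  using keys_add[of p q] by (auto simp: polys_def)

lemma uminus_in_polys: "p \<in> polys I \<Longrightarrow> - p \<in> polys I"
  by (auto simp: polys_def in_keys_iff)

lemma diff_in_polys: "p \<in> polys I \<Longrightarrow> q \<in> polys I \<Longrightarrow> p - q \<in> polys I"
  using add_in_polys[of p I "- q"] uminus_in_polys[of q I] by simp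

lemma keys_add_nat: "Poly_Mapping.keys (m + m' :: 'i \<Rightarrow>\<^sub>0 nat) = Poly_Mapping.keys m \<union> Poly_Mapping.keys m'"
  by (auto simp: in_keys_iff lookup_add)

lemma mult_in_polys: 
  assumes "p \<in> polys I" "q \<in> polys I" shows "p * q \<in> polys I"
proof -
  have "Poly_Mapping.keys m \<subseteq> I" if "m \<in> Poly_Mapping.keys (p * q)" for m
  proof -
    from that keys_mult[of p q] obtain a b
      where "m = a + b" "a \<in> Poly_Mapping.keys p" "b \<in> Poly_Mapping.keys q"
      by auto
    then show ?thesis using assms by (simp add: polys_def keys_add_nat)
  qed
  then show ?thesis by (simp add: polys_def)
qed

lemma sum_in_polys: "(\<And>x. x \<in> A \<Longrightarrow> f x \<in> polys I) \<Longrightarrow> sum f A \<in> polys I"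
  by (induction A rule: infinite_finite_induct) (auto intro: add_in_polys)

lemma prod_in_polys: "(\<And>x. x \<in> A \<Longrightarrow> f x \<in> polys I) \<Longrightarrow> prod f A \<in> polys I"
  by (induction A rule: infinite_finite_induct) (auto intro: mult_in_polys)

lemma polys_mono: "I \<subseteq> J \<Longrightarrow> polys I \<subseteq> polys J"
  by (auto simp: polys_def)

lemma polys_UNIV [simp]: "polys UNIV = UNIV"
  by (simp add: polys_def)

lemma lin_form_in_polys: "I \<subseteq> J \<Longrightarrow> lin_form I a \<in> polys J"
  unfolding lin_form_eq by (intro sum_in_polys mult_in_polys) auto

lemma polys_induct [consumes 1, case_names cst var_mult add]:
  assumes "p \<in> polys I"
    and "\<And>c. P (cst c)"
    and "\<And>i p. i \<in> I \<Longrightarrow> P p \<Longrightarrow> P (var i * p)"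
    and "\<And>p q. P p \<Longrightarrow> P q \<Longrightarrow> P (p + q)"
  shows "P (p :: ('i, 'k::field) mpoly)"
proof -
  have "P (\<Sum>m\<in>F. Poly_Mapping.single m (Poly_Mapping.lookup p m))"
    if "finite F" "F \<subseteq> Poly_Mapping.keys p" for F
    using that
  proof (induction F rule: finite_induct)
    case empty
    then show ?case using assms(2)[of 0] by simp
  next
    case (insert m F)
    have "Poly_Mapping.keys m \<subseteq> I"
      using assms(1) insert.prems by (auto simp: polys_def)
    then have "P (Poly_Mapping.single m (Poly_Mapping.lookup p m))"
      by (rule single_monomial_induct) (fact assms(2) assms(3))+
    moreover have "P (\<Sum>m\<in>F. Poly_Mapping.single m (Poly_Mapping.lookup p m))"
      using insert by blast
    ultimately show ?case
      unfolding sum.insert[OF insert.hyps] by (rule assms(4))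
  qed
  from this[of "Poly_Mapping.keys p"] show ?thesis
    unfolding poly_mapping_expand[of p, symmetric] by simp
qed

lemmas mpoly_induct = polys_induct[where I = UNIV, simplified, case_names cst var_mult add]

lemma finite_polys_index:
  fixes p :: "('i, 'k::field) mpoly"
  obtains I where "finite I" "p \<in> polys I"
  by (rule that[of "\<Union>m\<in>Poly_Mapping.keys p. Poly_Mapping.keys m"]) (auto simp: polys_def)

subsection \<open>Substitution\<close>

text \<open>The K-algebra homomorphism with prescribed images of the variables; restricting
  polynomials to a hyperplane is an instance.\<close>

definition subst :: "('i \<Rightarrow> ('j, 'k::field) mpoly) \<Rightarrow> ('i, 'k) mpoly \<Rightarrow> ('j, 'k) mpoly" where
  "subst g p = (\<Sum>m\<in>Poly_Mapping.keys p. cst (Poly_Mapping.lookup p m) *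
     (\<Prod>i\<in>Poly_Mapping.keys m. g i ^ Poly_Mapping.lookup m i))"

lemma subst_superset:
  assumes "finite F" "Poly_Mapping.keys p \<subseteq> F"
  shows "subst g p = (\<Sum>m\<in>F. cst (Poly_Mapping.lookup p m) *
     (\<Prod>i\<in>Poly_Mapping.keys m. g i ^ Poly_Mapping.lookup m i))"
  unfolding subst_def using assms by (intro sum.mono_neutral_left) (auto simp: in_keys_iff)

lemma subst_add: "subst g (p + q) = subst g p + subst g q"
proof -
  let ?F = "Poly_Mapping.keys p \<union> Poly_Mapping.keys q"
  show ?thesis
    using keys_add[of p q]
    by (simp add: subst_superset[of ?F] lookup_add cst_add distrib_right sum.distrib)
qed

lemma subst_single: "subst g (Poly_Mapping.single m c) =
    cst c * (\<Prod>i\<in>Poly_Mapping.keys m. g i ^ Poly_Mapping.lookup m i)"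
  by (subst subst_superset[of "{m}"]) auto

lemma subst_cst [simp]: "subst g (cst c) = cst c"
  by (simp add: cst_def subst_single)

lemma subst_0 [simp]: "subst g 0 = 0"
  using subst_cst[of g 0] by simp

lemma subst_1 [simp]: "subst g 1 = 1"
  using subst_cst[of g 1] by simp

lemma subst_var [simp]: "subst g (var i) = g i"
  by (simp add: var_def subst_single)

lemma subst_sum: "subst g (sum f A) = (\<Sum>x\<in>A. subst g (f x))"
  by (induction A rule: infinite_finite_induct) (auto simp: subst_add)

lemma subst_uminus: "subst g (- p) = - subst g p"
  using subst_add[of g p "- p"] by (simp add: eq_neg_iff_add_eq_0 add.commute)

lemma subst_diff: "subst g (p - q) = subst g p - subst g q"
  using subst_add[of g p "- q"] by (simp add: subst_uminus)

lemma subst_single_mult: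
  "subst g (Poly_Mapping.single m c * Poly_Mapping.single m' c') =
   subst g (Poly_Mapping.single m c) * subst g (Poly_Mapping.single m' c')"
proof -
  define F where "F = Poly_Mapping.keys m \<union> Poly_Mapping.keys m'"
  have ext: "(\<Prod>i\<in>Poly_Mapping.keys u. g i ^ Poly_Mapping.lookup u i) = (\<Prod>i\<in>F. g i ^ Poly_Mapping.lookup u i)"
    if "Poly_Mapping.keys u \<subseteq> F" for u
    using that by (intro prod.mono_neutral_left) (auto simp: F_def in_keys_iff)
  show ?thesis
    by (simp add: mult_single subst_single ext F_def[symmetric] keys_add_nat lookup_add power_add
        prod.distrib cst_mult mult_ac)
      (simp add: ext F_def)
qed

lemma subst_mult: "subst g (p * q) = subst g p * subst g q"
proof -
  let ?s = "\<lambda>p m. Poly_Mapping.single m (Poly_Mapping.lookup p m)"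
  have "p * q = (\<Sum>m\<in>Poly_Mapping.keys p. ?s p m) * (\<Sum>m\<in>Poly_Mapping.keys q. ?s q m)"
    by (simp flip: poly_mapping_expand)
  also have "subst g \<dots> = (\<Sum>m\<in>Poly_Mapping.keys p. subst g (?s p m)) * (\<Sum>m\<in>Poly_Mapping.keys q. subst g (?s q m))"
    by (simp add: sum_product subst_sum subst_single_mult)
  also have "\<dots> = subst g p * subst g q"
    by (simp flip: subst_sum poly_mapping_expand)
  finally show ?thesis .
qed

lemma subst_prod: "subst g (prod f A) = (\<Prod>x\<in>A. subst g (f x))"
  by (induction A rule: infinite_finite_induct) (auto simp: subst_mult)

lemma subst_dvd: "p dvd q \<Longrightarrow> subst g p dvd subst g q"
  by (metis dvd_def subst_mult)

lemma subst_in_polys: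
  assumes "p \<in> polys I" "\<And>i. i \<in> I \<Longrightarrow> g i \<in> polys J"
  shows "subst g p \<in> polys J"
  using assms(1)
  by (induction p rule: polys_induct)
    (auto simp: subst_mult subst_add intro: mult_in_polys add_in_polys assms(2))

lemma subst_subst: "subst h (subst g p) = subst (\<lambda>i. subst h (g i)) p"
  by (induction p rule: mpoly_induct) (auto simp: subst_mult subst_add)

lemma subst_id:
  assumes "p \<in> polys I" "\<And>i. i \<in> I \<Longrightarrow> g i = var i"
  shows "subst g p = p"
  using assms(1) by (induction p rule: polys_induct) (auto simp: subst_mult subst_add assms(2))

text \<open>The library only provides the domain property for linearly ordered sets of monomials,
  so finitely many variables are renamed to natural numbers.\<close>

lemma mpoly_mult_eq_0_iff: "p * q = 0 \<longleftrightarrow> p = 0 \<or> q = (0 :: ('i, 'k::field) mpoly)"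
proof
  assume "p * q = 0"
  obtain I J where IJ: "finite I" "p \<in> polys I" "finite J" "q \<in> polys J"
    using finite_polys_index by metis
  then obtain f :: "'i \<Rightarrow> nat" where f: "inj_on f (I \<union> J)"
    using finite_imp_inj_to_nat_seg[of "I \<union> J"] by blast
  define g where "g = subst (\<lambda>i. var (f i) :: (nat, 'k) mpoly)"
  define h where "h = subst (\<lambda>k. var (inv_into (I \<union> J) f k) :: ('i, 'k) mpoly)"
  have hg: "h (g r) = r" if "r \<in> polys (I \<union> J)" for r
    using that unfolding g_def h_def subst_subst by (rule subst_id) (simp add: f)
  have "g p * g q = 0"
    using \<open>p * q = 0\<close> by (simp add: g_def flip: subst_mult)
  then have "g p = 0 \<or> g q = 0"
    by simp
  moreover have "h (g p) = p" "h (g q) = q" "h 0 = 0"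
    using IJ polys_mono[of I "I \<union> J"] polys_mono[of J "I \<union> J"] by (auto intro!: hg) (simp add: h_def)
  ultimately show "p = 0 \<or> q = 0" by metis
qed auto

lemma mpoly_mult_left_cancel: "p \<noteq> 0 \<Longrightarrow> p * q = p * r \<longleftrightarrow> q = (r :: ('i, 'k::field) mpoly)"
  using mpoly_mult_eq_0_iff[of p "q - r"] by (auto simp: right_diff_distrib)

lemma mpoly_dvd_mult_cancel: "p \<noteq> 0 \<Longrightarrow> p * q dvd p * r \<longleftrightarrow> q dvd (r :: ('i, 'k::field) mpoly)"
  by (auto simp: dvd_def mult.assoc mpoly_mult_left_cancel)

lemma mpoly_prod_eq_0_iff:
  "finite A \<Longrightarrow> prod f A = (0 :: ('i, 'k::field) mpoly) \<longleftrightarrow> (\<exists>x\<in>A. f x = 0)"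
  by (induction A rule: finite_induct) (auto simp: mpoly_mult_eq_0_iff)

text \<open>\<open>dvd\<close> refers to the ring in all variables. Setting the variables outside
  \<open>I\<close> to 0 fixes \<open>p\<close> and \<open>q\<close> and moves the cofactor into
  \<open>polys I\<close>.\<close>

lemma polys_dvdE:
  assumes "p dvd q" "p \<in> polys I" "q \<in> polys I"
  obtains r where "r \<in> polys I" "q = p * r"
proof -
  obtain r where r: "q = p * r" using assms by blast
  let ?g = "\<lambda>i. if i \<in> I then var i else 0"
  have "subst ?g q = q" "subst ?g p = p"
    using assms by (auto intro: subst_id)
  then have "q = p * subst ?g r"
    using r by (metis subst_mult)
  moreover have "subst ?g r \<in> polys I"
    by (rule subst_in_polys[of _ UNIV]) auto
  ultimately show ?thesis using that by blast
qed

subsection \<open>Homogeneous components\<close>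

definition mdeg :: "('i \<Rightarrow>\<^sub>0 nat) \<Rightarrow> nat" where
  "mdeg m = (\<Sum>i\<in>Poly_Mapping.keys m. Poly_Mapping.lookup m i)"

lemma homogeneous_iff: "homogeneous d p \<longleftrightarrow> (\<forall>m\<in>Poly_Mapping.keys p. mdeg m = d)"
  by (simp add: homogeneous_def mdeg_def)

lemma mdeg_add: "mdeg (m + m') = mdeg m + mdeg m'"
proof -
  let ?F = "Poly_Mapping.keys m \<union> Poly_Mapping.keys m'"
  have "mdeg u = (\<Sum>i\<in>?F. Poly_Mapping.lookup u i)" if "Poly_Mapping.keys u \<subseteq> ?F" for u
    unfolding mdeg_def using that by (intro sum.mono_neutral_left) (auto simp: in_keys_iff)
  then show ?thesis by (simp add: keys_add_nat lookup_add sum.distrib)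
qed

definition hcomp :: "nat \<Rightarrow> ('i, 'k::field) mpoly \<Rightarrow> ('i, 'k) mpoly" where
  "hcomp d p = (\<Sum>m\<in>{m\<in>Poly_Mapping.keys p. mdeg m = d}. Poly_Mapping.single m (Poly_Mapping.lookup p m))"

lemma lookup_hcomp: "Poly_Mapping.lookup (hcomp d p) m = (if mdeg m = d then Poly_Mapping.lookup p m else 0)"
  by (auto simp: hcomp_def lookup_sum lookup_single when_def not_in_keys_iff_lookup_eq_zero)

lemma hcomp_add: "hcomp d (p + q) = hcomp d p + hcomp d q"
  by (rule poly_mapping_eqI) (simp add: lookup_hcomp lookup_add)

lemma hcomp_0 [simp]: "hcomp d 0 = 0"
  by (rule poly_mapping_eqI) (simp add: lookup_hcomp)

lemma hcomp_sum: "hcomp d (sum f A) = (\<Sum>x\<in>A. hcomp d (f x))"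
  by (induction A rule: infinite_finite_induct) (auto simp: hcomp_add)

lemma homogeneous_hcomp [simp]: "homogeneous d (hcomp d p)"
  by (auto simp: homogeneous_iff in_keys_iff lookup_hcomp split: if_splits)

lemma hcomp_in_polys: "p \<in> polys I \<Longrightarrow> hcomp d p \<in> polys I"
  by (auto simp: polys_def in_keys_iff lookup_hcomp split: if_splits)

lemma homogeneous_imp_hcomp: "homogeneous e p \<Longrightarrow> hcomp d p = (if d = e then p else 0)"
  by (rule poly_mapping_eqI) (auto simp: lookup_hcomp homogeneous_iff in_keys_iff)

lemma homogeneous_0 [simp]: "homogeneous d 0"
  by (simp add: homogeneous_iff)

lemma homogeneous_cst [simp]: "homogeneous 0 (cst c)"
  by (simp add: homogeneous_iff cst_def mdeg_def)

lemma homogeneous_1 [simp]: "homogeneous 0 1"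
  using homogeneous_cst[of 1] by simp

lemma homogeneous_var [simp]: "homogeneous 1 (var i)"
  by (simp add: homogeneous_iff mdeg_def)

lemma homogeneous_add: "homogeneous d p \<Longrightarrow> homogeneous d q \<Longrightarrow> homogeneous d (p + q)"
  using keys_add[of p q] by (auto simp: homogeneous_iff)

lemma homogeneous_uminus: "homogeneous d p \<Longrightarrow> homogeneous d (- p)"
  by (auto simp: homogeneous_iff in_keys_iff)

lemma homogeneous_diff: "homogeneous d p \<Longrightarrow> homogeneous d q \<Longrightarrow> homogeneous d (p - q)"
  using homogeneous_add[of d p "- q"] homogeneous_uminus[of d q] by simp

lemma homogeneous_sum: "(\<And>x. x \<in> A \<Longrightarrow> homogeneous d (f x)) \<Longrightarrow> homogeneous d (sum f A)"
  by (induction A rule: infinite_finite_induct) (auto intro: homogeneous_add)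

lemma homogeneous_mult:
  assumes "homogeneous d p" "homogeneous e q" shows "homogeneous (d + e) (p * q)"
  using assms keys_mult[of p q] by (fastforce simp: homogeneous_iff mdeg_add)

lemma homogeneous_cst_mult: "homogeneous d p \<Longrightarrow> homogeneous d (cst c * p)"
  using homogeneous_mult[of 0 "cst c" d p] by simp

lemma homogeneous_prod:
  "(\<And>x. x \<in> A \<Longrightarrow> homogeneous 1 (f x)) \<Longrightarrow> finite A \<Longrightarrow> homogeneous (card A) (prod f A)"
proof (induction A rule: infinite_finite_induct)
  case (insert x A)
  then show ?case using homogeneous_mult[of 1 "f x" "card A" "prod f A"] by simp
qed auto

lemma homogeneous_lin_form: "homogeneous 1 (lin_form I a)"
  unfolding lin_form_eq by (intro homogeneous_sum homogeneous_cst_mult homogeneous_var)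

text \<open>Forcing a prescribed degree into \<open>D\<close> lets a sum over \<open>D\<close>
  collapse at that degree without asking whether the component vanishes.\<close>

lemma hcomp_expand: 
  fixes p :: "('i, 'k::field) mpoly"
  shows "\<exists>D. finite D \<and> p = (\<Sum>d\<in>D. hcomp d p) \<and> d \<in> D"
proof -
  let ?D = "insert d (mdeg ` Poly_Mapping.keys p)"
  have "p = (\<Sum>d\<in>?D. hcomp d p)"
    by (rule poly_mapping_eqI)
      (auto simp: lookup_sum lookup_hcomp in_keys_iff)
  then show ?thesis by (intro exI[of _ ?D]) auto
qed

lemma hcomp_mult:
  assumes "homogeneous e q"
  shows "hcomp d (p * q) = (if e \<le> d then hcomp (d - e) p * q else 0)"
proof -
  obtain D where D: "finite D" "p = (\<Sum>k\<in>D. hcomp k p)" "d - e \<in> D"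
    using hcomp_expand[of p "d - e"] by blast
  have "hcomp d (p * q) = (\<Sum>k\<in>D. hcomp d (hcomp k p * q))"
    by (metis D(2) sum_distrib_right hcomp_sum)
  also have "\<dots> = (\<Sum>k\<in>D. if k = d - e \<and> e \<le> d then hcomp k p * q else 0)"
    using assms homogeneous_mult[OF homogeneous_hcomp]
    by (intro sum.cong) (auto simp: homogeneous_imp_hcomp[OF homogeneous_mult[OF homogeneous_hcomp assms]])
  also have "\<dots> = (if e \<le> d then hcomp (d - e) p * q else 0)"
    using D by auto
  finally show ?thesis .
qed

lemma subst_homogeneous:
  assumes "homogeneous d p" "\<And>i. homogeneous 1 (g i)"
  shows "homogeneous d (subst g p)"
proof -
  have pw: "homogeneous k (g i ^ k)" for i k
    using homogeneous_prod[of "{..<k}" "\<lambda>_. g i"] assms(2) by simp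
  have "homogeneous (\<Sum>i\<in>F. Poly_Mapping.lookup m i) (\<Prod>i\<in>F. g i ^ Poly_Mapping.lookup m i)"
    if "finite F" for F m
    using that by (induction F) (auto intro: homogeneous_mult pw)
  then have "homogeneous (mdeg m) (\<Prod>i\<in>Poly_Mapping.keys m. g i ^ Poly_Mapping.lookup m i)" for m
    by (simp add: mdeg_def)
  then show ?thesis
    unfolding subst_def using assms(1)
    by (intro homogeneous_sum homogeneous_cst_mult) (auto simp: homogeneous_iff[of d p])
qed

subsection \<open>Divisibility by linear forms\<close>

lemma pdiff_0 [simp]: "pdiff k 0 = 0"
  by (simp add: pdiff_def)

lemma lin_form_eq_0D:
  assumes "finite I" "lin_form I a = 0" "k \<in> I" shows "a k = 0"
  using pdiff_lin_form[OF assms(1,3), of a] assms(2)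
  by (metis pdiff_0 cst_def cst_eq_0_iff)

text \<open>For \<open>a k \<noteq> 0\<close>, this is the equation \<open>lin_form I a = 0\<close>
  solved for the variable \<open>k\<close>. Substituting it realises the quotient by the form as a
  map into the polynomials without \<open>k\<close>.\<close>

definition elim_var :: "'i set \<Rightarrow> ('i \<Rightarrow> 'k) \<Rightarrow> 'i \<Rightarrow> 'i \<Rightarrow> ('i, 'k::field) mpoly" where
  "elim_var I a k = (\<lambda>i. if i = k then - (\<Sum>j\<in>I - {k}. cst (a j / a k) * var j) else var i)"

lemma subst_elim_var_lin_form:
  assumes "finite I" "k \<in> I" "a k \<noteq> 0"
  shows "subst (elim_var I a k) (lin_form I b) = lin_form (I - {k}) (\<lambda>j. b j - b k * (a j / a k))"
proof -
  have "subst (elim_var I a k) (lin_form I b) = (\<Sum>i\<in>I. cst (b i) * elim_var I a k i)"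
    by (simp add: lin_form_eq subst_sum subst_mult)
  also have "\<dots> = cst (b k) * elim_var I a k k + (\<Sum>i\<in>I - {k}. cst (b i) * elim_var I a k i)"
    using assms by (simp add: sum.remove)
  also have "(\<Sum>i\<in>I - {k}. cst (b i) * elim_var I a k i) = (\<Sum>i\<in>I - {k}. cst (b i) * var i)"
    by (intro sum.cong) (auto simp: elim_var_def)
  also have "cst (b k) * elim_var I a k k = - (\<Sum>j\<in>I - {k}. cst (b k * (a j / a k)) * var j)"
    by (simp add: elim_var_def sum_distrib_left cst_mult[of "b k"] mult.assoc del: times_divide_eq_right)
  finally show ?thesis
    by (simp add: lin_form_eq cst_diff left_diff_distrib sum_subtractf)
qed

text \<open>Elimination moves a variable only by a multiple of the form, and this property passes to
  sums and products. It is the harder half of the fact that the kernel of the elimination is the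
  ideal of the form.\<close>

lemma lin_form_dvd_diff_subst:
  assumes "finite I" "k \<in> I" "a k \<noteq> 0"
  shows "lin_form I a dvd p - subst (elim_var I a k) p"
proof (induction p rule: mpoly_induct)
  case (var_mult i p)
  have "lin_form I a dvd var i - elim_var I a k i"
  proof (cases "i = k")
    case True
    have "lin_form I a = cst (a k) * var k + (\<Sum>j\<in>I - {k}. cst (a j) * var j)"
      using assms by (simp add: lin_form_eq sum.remove)
    also have "(\<Sum>j\<in>I - {k}. cst (a j) * var j) = cst (a k) * (\<Sum>j\<in>I - {k}. cst (a j / a k) * var j)"
      using assms(3) by (simp add: sum_distrib_left flip: mult.assoc cst_mult)
    finally have "lin_form I a = cst (a k) * (var i - elim_var I a k i)"
      using True by (simp add: elim_var_def distrib_left)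
    then have "var i - elim_var I a k i = lin_form I a * cst (inverse (a k))"
      using cst_inverse_mult[OF assms(3)] by (metis mult.commute)
    then show ?thesis by simp
  qed (simp add: elim_var_def)
  then have "lin_form I a dvd var i * (p - subst (elim_var I a k) p)
      + (var i - elim_var I a k i) * subst (elim_var I a k) p"
    using var_mult by (intro dvd_add dvd_mult dvd_mult2)
  then show ?case by (simp add: subst_mult algebra_simps)
next
  case (add p q)
  then have "lin_form I a dvd (p - subst (elim_var I a k) p) + (q - subst (elim_var I a k) q)"
    by (rule dvd_add)
  then show ?case by (simp add: subst_add algebra_simps)
qed simp

lemma lin_form_dvd_iff:
  assumes "finite I" "k \<in> I" "a k \<noteq> 0"
  shows "lin_form I a dvd p \<longleftrightarrow> subst (elim_var I a k) p = 0"
proof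
  have "subst (elim_var I a k) (lin_form I a) = 0"
    unfolding subst_elim_var_lin_form[where a = a, OF assms] using assms(3) by (simp add: lin_form_eq)
  then show "subst (elim_var I a k) p = 0" if "lin_form I a dvd p"
    using subst_dvd[OF that, of "elim_var I a k"] by simp
next
  show "lin_form I a dvd p" if "subst (elim_var I a k) p = 0"
    using lin_form_dvd_diff_subst[where a = a, OF assms, of p] that by simp
qed

text \<open>The form generates the kernel of a homomorphism into an integral domain.\<close>

lemma prime_elem_lin_form:
  assumes "finite I" "k \<in> I" "a k \<noteq> 0"
  shows "prime_elem (lin_form I a)"
  using lin_form_eq_0D[OF assms(1) _ assms(2), of a] assms(3)
  by (auto intro!: prime_elemI simp: lin_form_dvd_iff[where a = a, OF assms] subst_mult mpoly_mult_eq_0_iff)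

lemma lin_form_dvd_lin_formD:
  assumes "finite I" "k \<in> I" "a k \<noteq> 0" "lin_form I a dvd lin_form I b" "j \<in> I"
  shows "b j = b k / a k * a j"
proof (cases "j = k")
  case False
  have "lin_form (I - {k}) (\<lambda>j. b j - b k * (a j / a k)) = 0"
    using assms(4) unfolding lin_form_dvd_iff[where a = a, OF assms(1-3)] subst_elim_var_lin_form[where a = a, OF assms(1-3)] .
  from lin_form_eq_0D[OF _ this, of j] show ?thesis
    using assms False by simp
qed (use assms in simp)

lemma prime_elem_dvd_prodD:
  assumes "prime_elem p" "finite A" "p dvd prod f A"
  shows "\<exists>x\<in>A. p dvd f x"
  using assms(2,3)
proof (induction A rule: finite_induct)
  case empty
  then show ?case using assms(1) by (simp add: prime_elem_def)
next
  case (insert x A)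
  then show ?case using prime_elem_dvd_multD[OF assms(1)] by auto
qed

text \<open>The product of the earlier primes is cancelled before the next one is treated, so the
  primes \<open>u x\<close> may be associated to each other.\<close>

lemma prod_primes_dvd_mult_cancel:
  fixes u :: "'a \<Rightarrow> ('i, 'k::field) mpoly"
  assumes "finite F" "\<And>x. x \<in> F \<Longrightarrow> prime_elem (u x)" "\<And>x. x \<in> F \<Longrightarrow> \<not> u x dvd v"
    and "prod u F dvd v * q"
  shows "prod u F dvd q"
  using assms
proof (induction F arbitrary: q rule: finite_induct)
  case (insert x F)
  have "prod u F dvd v * q"
    using insert.prems(3) insert.hyps dvd_mult_right[of "u x" "prod u F"] by simp
  then have "prod u F dvd q"
    by (rule insert.IH[rotated 2]) (use insert.prems(1,2) in blast)+
  then obtain q' where q': "q = prod u F * q'" ..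
  have "prod u F \<noteq> 0"
    using insert.prems(1) insert.hyps by (auto simp: mpoly_prod_eq_0_iff prime_elem_def)
  moreover have "prod u F * u x dvd prod u F * (v * q')"
    using insert.prems(3) insert.hyps by (simp add: q' mult_ac)
  ultimately have "u x dvd v * q'"
    by (simp add: mpoly_dvd_mult_cancel)
  then have "u x dvd q'"
    using prime_elem_dvd_multD[of "u x" v q'] insert.prems(1,2)[of x] by simp
  then have "u x * prod u F dvd q' * prod u F"
    by (rule mult_dvd_mono) simp
  then show ?case
    using insert.hyps by (simp add: q' mult.commute)
qed simp

text \<open>Made for restricted forms: hyperplanes with the same trace on \<open>H\<close> have
  proportional forms there, so divisibility by each factor of a class would be too weak. The product
  of a class is therefore assumed to divide, and coprimality is asked only between classes.\<close>

lemma grouped_prod_dvd: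
  fixes u :: "'a \<Rightarrow> ('i, 'k::field) mpoly"
  assumes fin: "finite S" and prime: "\<And>x. x \<in> S \<Longrightarrow> prime_elem (u x)"
    and cop: "\<And>x y. x \<in> S \<Longrightarrow> y \<in> S \<Longrightarrow> r x \<noteq> r y \<Longrightarrow> \<not> u x dvd u y"
    and dvd: "\<And>c. (\<Prod>x\<in>{x\<in>S. r x = c}. u x) dvd h"
  shows "prod u S dvd h"
proof -
  have "(\<Prod>c\<in>T. \<Prod>x\<in>{x\<in>S. r x = c}. u x) dvd h" if "finite T" for T
    using that
  proof (induction T rule: finite_induct)
    case (insert c T)
    then obtain q where q: "h = (\<Prod>c\<in>T. \<Prod>x\<in>{x\<in>S. r x = c}. u x) * q" by blast
    have "(\<Prod>x\<in>{x\<in>S. r x = c}. u x) dvd q"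
    proof (rule prod_primes_dvd_mult_cancel)
      fix x assume x: "x \<in> {x\<in>S. r x = c}"
      then show p: "prime_elem (u x)" using prime by blast
      show "\<not> u x dvd (\<Prod>c\<in>T. \<Prod>x\<in>{x\<in>S. r x = c}. u x)"
      proof
        assume "u x dvd (\<Prod>c\<in>T. \<Prod>x\<in>{x\<in>S. r x = c}. u x)"
        then obtain d where d: "d \<in> T" "u x dvd (\<Prod>x\<in>{x\<in>S. r x = d}. u x)"
          using prime_elem_dvd_prodD[OF p insert.hyps(1)] by blast
        then obtain y where "y \<in> S" "r y = d" "u x dvd u y"
          using prime_elem_dvd_prodD[OF p _ d(2)] fin by auto
        moreover have "r x \<noteq> d"
          using x d(1) insert.hyps by auto
        ultimately show False using cop[of x y] x by auto
      qed
    qed (use fin dvd[of c] q in auto)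
    then have "(\<Prod>x\<in>{x\<in>S. r x = c}. u x) * (\<Prod>c\<in>T. \<Prod>x\<in>{x\<in>S. r x = c}. u x)
        dvd q * (\<Prod>c\<in>T. \<Prod>x\<in>{x\<in>S. r x = c}. u x)"
      by (rule mult_dvd_mono) simp
    then show ?case
      using insert.hyps by (simp add: q mult.commute)
  qed simp
  from this[of "r ` S"] show ?thesis
    using fin by (simp add: prod.group)
qed

subsection \<open>Logarithmic derivations\<close>

text \<open>The partial derivatives of a linear form are constants, which reduces
  \<open>apply_derivation\<close> to this expression, linear in \<open>a\<close> as well as in
  \<open>\<theta>\<close>.\<close>

definition dval :: "'i set \<Rightarrow> ('i \<Rightarrow> ('i, 'k::field) mpoly) \<Rightarrow> ('i \<Rightarrow> 'k) \<Rightarrow> ('i, 'k) mpoly" where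
  "dval I \<theta> a = (\<Sum>k\<in>I. cst (a k) * \<theta> k)"

lemma apply_derivation_lin_form:
  "finite I \<Longrightarrow> apply_derivation I \<theta> (lin_form I a) = dval I \<theta> a"
  unfolding apply_derivation_def dval_def
  by (intro sum.cong) (simp_all add: pdiff_lin_form mult.commute flip: cst_def)

lemma dval_in_polys: "\<theta> \<in> derivations I \<Longrightarrow> dval I \<theta> a \<in> polys I"
  unfolding dval_def derivations_def by (intro sum_in_polys mult_in_polys) auto

lemma dval_lincomb_form:
  assumes "\<And>i. i \<in> I \<Longrightarrow> c i = s * a i + t * b i"
  shows "dval I \<theta> c = cst s * dval I \<theta> a + cst t * dval I \<theta> b"
  unfolding dval_def sum_distrib_left sum.distrib[symmetric]
  by (intro sum.cong) (simp_all add: assms cst_add cst_mult algebra_simps)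

lemma dval_lincomb: "dval I (\<lambda>k. \<Sum>x\<in>B. c x * v x k) a = (\<Sum>x\<in>B. c x * dval I (v x) a)"
  unfolding dval_def sum_distrib_left
  by (subst sum.swap) (simp add: mult_ac)

lemma dval_mult: "dval I (\<lambda>k. p * \<theta> k) a = p * dval I \<theta> a"
  by (simp add: dval_def sum_distrib_left mult_ac)

lemma dval_diff: "dval I (\<lambda>k. \<theta> k - \<eta> k) a = dval I \<theta> a - dval I \<eta> a"
  by (simp add: dval_def right_diff_distrib sum_subtractf)

lemma lin_form_lincomb:
  assumes "\<And>i. i \<in> I \<Longrightarrow> c i = s * a i + t * b i"
  shows "lin_form I c = cst s * lin_form I a + cst t * lin_form I b"
  using dval_lincomb_form[where I = I and c = c and \<theta> = var, OF assms] by (simp add: dval_def lin_form_eq)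

section \<open>Hyperplanes and the forms that define them\<close>

lemma hyperplane_of_eq_imp_proportional:
  assumes "finite I" "k \<in> I" "a k \<noteq> 0" "hyperplane_of I a \<subseteq> hyperplane_of I b" "j \<in> I"
  shows "b j = b k / a k * a j"
proof (cases "j = k")
  case False
  \<comment> \<open>The vector of the hyperplane of \<open>a\<close> supported on \<open>j\<close>
    and \<open>k\<close>; that \<open>b\<close> vanishes on it is the claim.\<close>
  define x where "x i = (if i = j then 1 else if i = k then - a j / a k else 0)" for i
  have sum: "(\<Sum>i\<in>I. c i * x i) = c j - c k * (a j / a k)" for c
  proof -
    have "(\<Sum>i\<in>I. c i * x i) = (\<Sum>i\<in>{j, k}. c i * x i)"
      using assms by (intro sum.mono_neutral_right) (auto simp: x_def)
    then show ?thesis using False by (simp add: x_def)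
  qed
  have "x \<in> hyperplane_of I a"
    using assms unfolding hyperplane_of_def coord_space_def by (simp add: sum) (auto simp: x_def)
  then have "x \<in> hyperplane_of I b"
    using assms(4) by blast
  then show ?thesis
    by (simp add: hyperplane_of_def sum)
qed (use assms in simp)

lemma hyperplane_of_proportional:
  assumes "\<And>j. j \<in> I \<Longrightarrow> b j = c * a j" "c \<noteq> 0"
  shows "hyperplane_of I a = hyperplane_of I b"
proof -
  have "(\<Sum>i\<in>I. b i * x i) = c * (\<Sum>i\<in>I. a i * x i)" for x
    unfolding sum_distrib_left by (intro sum.cong) (simp_all add: assms(1) mult.assoc)
  then show ?thesis using assms(2) by (simp add: hyperplane_of_def)
qed

lemma lin_form_dvd_imp_hyperplane_eq:
  assumes "finite I" "defining_form I a H" "defining_form I b H'" "lin_form I a dvd lin_form I b"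
  shows "H = H'"
proof -
  obtain k where k: "k \<in> I" "a k \<noteq> 0" using assms(2) by (auto simp: defining_form_def)
  note b_eq = lin_form_dvd_lin_formD[where a = a, OF assms(1) k assms(4)]
  have "b k / a k \<noteq> 0"
    using assms(3) b_eq by (auto simp: defining_form_def)
  with b_eq show ?thesis
    using hyperplane_of_proportional[of I b "b k / a k" a] assms(2,3) by (simp add: defining_form_def)
qed

lemma prime_elem_defining_form:
  "finite I \<Longrightarrow> defining_form I a H \<Longrightarrow> prime_elem (lin_form I a)"
  by (auto simp: defining_form_def intro: prime_elem_lin_form)

text \<open>All forms of one hyperplane are nonzero multiples of each other, so one chosen form per
  hyperplane can replace the quantifier over forms in the definition. \<open>polys_dvdE\<close>
  replaces the quotient in \<open>polys I\<close> by plain divisibility.\<close>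

lemma log_derivations_iff:
  assumes fin: "finite I" and f: "\<And>H. H \<in> A \<Longrightarrow> defining_form I (f H) H"
  shows "\<theta> \<in> log_derivations I A \<longleftrightarrow>
    \<theta> \<in> derivations I \<and> (\<forall>H\<in>A. lin_form I (f H) dvd dval I \<theta> (f H))"
proof
  assume "\<theta> \<in> log_derivations I A"
  then show "\<theta> \<in> derivations I \<and> (\<forall>H\<in>A. lin_form I (f H) dvd dval I \<theta> (f H))"
    using f unfolding log_derivations_def apply_derivation_lin_form[OF fin] by fastforce
next
  assume \<theta>: "\<theta> \<in> derivations I \<and> (\<forall>H\<in>A. lin_form I (f H) dvd dval I \<theta> (f H))"
  have "\<exists>q\<in>polys I. dval I \<theta> a = lin_form I a * q" if H: "H \<in> A" and a: "defining_form I a H" for H a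
  proof -
    obtain k where k: "k \<in> I" "f H k \<noteq> 0" using f[OF H] by (auto simp: defining_form_def)
    \<comment> \<open>The zero summand gives the equation the two-term shape of
      \<open>dval_lincomb_form\<close>.\<close>
    have a_eq: "a j = a k / f H k * f H j + 0 * f H j" if "j \<in> I" for j
      using hyperplane_of_eq_imp_proportional[where a = "f H", OF fin k _ that, of a] a f[OF H]
      by (simp add: defining_form_def)
    define c where "c = a k / f H k"
    have c: "c \<noteq> 0" using a a_eq by (auto simp: defining_form_def c_def)
    have "dval I \<theta> a = cst c * dval I \<theta> (f H)" "lin_form I a = cst c * lin_form I (f H)"
      using dval_lincomb_form[where I = I and c = a, OF a_eq] lin_form_lincomb[where I = I and c = a, OF a_eq]
      by (simp_all add: c_def)
    moreover have "lin_form I (f H) dvd dval I \<theta> (f H)"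
      using \<theta> H by blast
    ultimately have "lin_form I a dvd dval I \<theta> a"
      by (simp add: mult_dvd_mono)
    then show ?thesis
      using \<theta> by (metis polys_dvdE dval_in_polys lin_form_in_polys order_refl)
  qed
  then show "\<theta> \<in> log_derivations I A"
    using \<theta> by (auto simp: log_derivations_def apply_derivation_lin_form[OF fin])
qed

subsection \<open>Restriction to a coordinate hyperplane\<close>

text \<open>Normal form of the hyperplane \<open>H\<close> to be added: an equation solved for the
  coordinate \<open>i0\<close>. Restriction to \<open>H\<close> is then explicit at every level,
  with values over \<open>J\<close>: \<open>\<phi>\<close> parametrises the points,
  \<open>\<sigma>\<close> restricts polynomials, \<open>restr_form\<close> linear forms and
  \<open>restr_hyp\<close> hyperplanes.\<close>

locale elimination =
  fixes I :: "'i set" and i0 :: 'i and b :: "'i \<Rightarrow> 'k::field"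
  assumes fin: "finite I" and i0: "i0 \<in> I"
begin

definition "J = I - {i0}"

definition "\<alpha> = (\<lambda>i. if i = i0 then 1 else if i \<in> J then - b i else 0)"

definition "\<phi> x = (\<lambda>i. if i = i0 then \<Sum>j\<in>J. b j * x j else x i)"

definition "\<sigma> = subst (\<lambda>i. if i = i0 then \<Sum>j\<in>J. cst (b j) * var j else var i)"

definition "H = hyperplane_of I \<alpha>"

definition "restr_form c = (\<lambda>j. if j \<in> J then c j + c i0 * b j else 0)"

definition "restr_hyp X = {x \<in> coord_space J. \<phi> x \<in> X}"

lemma finJ: "finite J" and i0_notin_J: "i0 \<notin> J" and J_subset: "J \<subseteq> I" and mem_I: "i \<in> I \<longleftrightarrow> i = i0 \<or> i \<in> J"
  using fin i0 by (auto simp: J_def)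

lemma sum_I: "sum f I = f i0 + sum f J"
  using sum.remove[OF fin i0] by (simp add: J_def)

lemma defining_form_\<alpha>: "defining_form I \<alpha> H"
  using i0 by (auto simp: defining_form_def H_def coord_space_def \<alpha>_def J_def)

lemma mem_H: "x \<in> H \<longleftrightarrow> x \<in> coord_space I \<and> x i0 = (\<Sum>j\<in>J. b j * x j)"
proof -
  have "(\<Sum>j\<in>J. \<alpha> j * x j) = - (\<Sum>j\<in>J. b j * x j)"
    unfolding sum_negf[symmetric] using i0_notin_J by (intro sum.cong) (auto simp: \<alpha>_def)
  then show ?thesis
    by (simp add: H_def hyperplane_of_def sum_I \<alpha>_def[of ])
qed

lemma dvd_iff_\<sigma>: "lin_form I \<alpha> dvd p \<longleftrightarrow> \<sigma> p = 0"
proof -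
  have "elim_var I \<alpha> i0 = (\<lambda>i. if i = i0 then \<Sum>j\<in>J. cst (b j) * var j else var i)"
    unfolding elim_var_def J_def[symmetric] sum_negf[symmetric]
    using i0_notin_J by (intro ext if_cong sum.cong) (auto simp: \<alpha>_def cst_uminus)
  then show ?thesis
    using lin_form_dvd_iff[OF fin i0, of \<alpha> p] by (simp add: \<sigma>_def \<alpha>_def)
qed

lemma \<sigma>_lin_form: "\<sigma> (lin_form I c) = lin_form J (restr_form c)"
proof -
  have "\<sigma> (lin_form I c) = cst (c i0) * (\<Sum>j\<in>J. cst (b j) * var j) + (\<Sum>j\<in>J. cst (c j) * var j)"
    unfolding lin_form_eq sum_I \<sigma>_def using i0_notin_J
    by (simp add: subst_add subst_mult subst_sum) (intro sum.cong, auto)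
  then show ?thesis
    by (simp add: lin_form_eq restr_form_def cst_add cst_mult sum_distrib_left algebra_simps
        flip: sum.distrib)
qed

lemma \<sigma>_in_polys: "p \<in> polys I \<Longrightarrow> \<sigma> p \<in> polys J"
  unfolding \<sigma>_def by (erule subst_in_polys) (auto simp: mem_I intro!: sum_in_polys mult_in_polys)

lemma \<sigma>_id: "p \<in> polys J \<Longrightarrow> \<sigma> p = p"
  unfolding \<sigma>_def using i0_notin_J by (erule_tac subst_id) auto

lemma \<sigma>_homogeneous: "homogeneous d p \<Longrightarrow> homogeneous d (\<sigma> p)"
  unfolding \<sigma>_def
  by (erule subst_homogeneous) (auto intro!: homogeneous_sum homogeneous_cst_mult homogeneous_var[unfolded One_nat_def])

lemma \<sigma>_simps: "\<sigma> (p + q) = \<sigma> p + \<sigma> q" "\<sigma> (p - q) = \<sigma> p - \<sigma> q" "\<sigma> (p * q) = \<sigma> p * \<sigma> q"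
  "\<sigma> (cst c) = cst c" "\<sigma> 0 = 0" "\<sigma> (sum f A) = (\<Sum>x\<in>A. \<sigma> (f x))" "\<sigma> (prod f A) = (\<Prod>x\<in>A. \<sigma> (f x))"
  by (simp_all add: \<sigma>_def subst_add subst_diff subst_mult subst_sum subst_prod)

lemma \<phi>_linear_coordinates: "linear_coordinates J \<phi> H"
proof -
  have "bij_betw \<phi> (coord_space J) H"
  proof (rule bij_betw_byWitness[where f' = "\<lambda>x i. if i = i0 then 0 else x i"])
    have "(\<Sum>j\<in>J. b j * (if j = i0 then c else x j)) = (\<Sum>j\<in>J. b j * x j)" for c x
      using i0_notin_J by (intro sum.cong) auto
    then show "\<forall>x\<in>H. \<phi> (\<lambda>i. if i = i0 then 0 else x i) = x" "\<phi> ` coord_space J \<subseteq> H"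
      by (auto simp: mem_H \<phi>_def fun_eq_iff coord_space_def mem_I)
  qed (use i0_notin_J in \<open>auto simp: \<phi>_def fun_eq_iff coord_space_def mem_H mem_I\<close>)
  then show ?thesis
    by (auto simp: linear_coordinates_def finJ \<phi>_def fun_eq_iff sum.distrib sum_distrib_left algebra_simps)
qed

lemma \<phi>_in_H: "x \<in> coord_space J \<Longrightarrow> \<phi> x \<in> H"
  using \<phi>_linear_coordinates by (auto simp: linear_coordinates_def bij_betw_def)

text \<open>\<open>\<phi>\<close> takes values in \<open>H\<close>, so intersecting with
  \<open>H\<close> makes no difference in the coordinates of \<open>J\<close>.\<close>

lemma pullback_restriction: "pullback J \<phi> (restriction A H) = restr_hyp ` (A - {H})"
  unfolding pullback_def restriction_def image_image restr_hyp_def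
  by (intro image_cong refl) (auto simp: \<phi>_in_H)

lemma restr_hyp_hyperplane_of: "restr_hyp (hyperplane_of I c) = hyperplane_of J (restr_form c)"
proof -
  have "(\<Sum>i\<in>I. c i * \<phi> x i) = (\<Sum>j\<in>J. restr_form c j * x j)" for x
  proof -
    have "(\<Sum>j\<in>J. c j * \<phi> x j) = (\<Sum>j\<in>J. c j * x j)"
      using i0_notin_J by (intro sum.cong) (auto simp: \<phi>_def)
    then show ?thesis
      by (simp add: sum_I \<phi>_def restr_form_def sum_distrib_left sum.distrib[symmetric] algebra_simps)
  qed
  then show ?thesis
    using \<phi>_in_H by (auto simp: restr_hyp_def hyperplane_of_def mem_H)
qed

text \<open>\<open>\<alpha>\<close> has coefficient 1 at \<open>i0\<close>, which fixes the factor
  by which a form vanishing on \<open>H\<close> is a multiple of it.\<close>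

lemma restr_form_eq_0:
  assumes "\<And>j. j \<in> J \<Longrightarrow> restr_form c j = 0" "i \<in> I"
  shows "c i = c i0 * \<alpha> i"
  using assms i0_notin_J by (auto simp: mem_I restr_form_def \<alpha>_def eq_neg_iff_add_eq_0)

lemma defining_form_restr:
  assumes c: "defining_form I c X" and "X \<noteq> H"
  shows "defining_form J (restr_form c) (restr_hyp X)"
proof -
  have "\<exists>j\<in>J. restr_form c j \<noteq> 0"
  proof (rule ccontr)
    assume "\<not> ?thesis"
    then have eq: "c i = c i0 * \<alpha> i" if "i \<in> I" for i
      using restr_form_eq_0 that by blast
    then have "c i0 \<noteq> 0"
      using c by (auto simp: defining_form_def)
    with eq have "hyperplane_of I \<alpha> = hyperplane_of I c"
      by (rule hyperplane_of_proportional)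
    then show False
      using c \<open>X \<noteq> H\<close> by (simp add: defining_form_def H_def)
  qed
  moreover have "X = hyperplane_of I c"
    using c by (simp add: defining_form_def)
  ultimately show ?thesis
    by (simp add: defining_form_def restr_hyp_hyperplane_of) (simp add: coord_space_def restr_form_def)
qed

text \<open>Restricting a derivation to \<open>H\<close> commutes with applying it to a form up to
  its normal component, the value on \<open>\<alpha>\<close>. Hence a derivation tangent to
  \<open>H\<close>, one with \<open>\<sigma> (dval I \<theta> \<alpha>) = 0\<close>, induces a
  derivation on \<open>H\<close>.\<close>

lemma \<sigma>_dval: "\<sigma> (dval I \<theta> c) = dval J (\<lambda>k. \<sigma> (\<theta> k)) (restr_form c) + cst (c i0) * \<sigma> (dval I \<theta> \<alpha>)"
proof -
  have "(\<Sum>j\<in>J. cst (\<alpha> j) * \<sigma> (\<theta> j)) = - (\<Sum>j\<in>J. cst (b j) * \<sigma> (\<theta> j))"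
    unfolding sum_negf[symmetric] using i0_notin_J by (intro sum.cong) (auto simp: \<alpha>_def cst_uminus)
  then have "\<sigma> (dval I \<theta> \<alpha>) = \<sigma> (\<theta> i0) - (\<Sum>j\<in>J. cst (b j) * \<sigma> (\<theta> j))"
    by (simp add: dval_def \<sigma>_simps sum_I) (simp add: \<alpha>_def)
  then have "\<sigma> (\<theta> i0) = \<sigma> (dval I \<theta> \<alpha>) + (\<Sum>j\<in>J. cst (b j) * \<sigma> (\<theta> j))"
    by simp
  moreover have "dval J (\<lambda>k. \<sigma> (\<theta> k)) (restr_form c) =
      (\<Sum>j\<in>J. cst (c j) * \<sigma> (\<theta> j)) + cst (c i0) * (\<Sum>j\<in>J. cst (b j) * \<sigma> (\<theta> j))"
    by (simp add: dval_def restr_form_def cst_add cst_mult sum_distrib_left sum.distrib[symmetric] algebra_simps)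
  moreover have "\<sigma> (dval I \<theta> c) = cst (c i0) * \<sigma> (\<theta> i0) + (\<Sum>j\<in>J. cst (c j) * \<sigma> (\<theta> j))"
    by (simp add: dval_def \<sigma>_simps sum_I)
  ultimately show ?thesis
    by (simp add: distrib_left)
qed

text \<open>Write \<open>x\<close> and \<open>y\<close> for the linear forms of \<open>a\<close> and \<open>\<alpha>\<close>. If \<open>\<theta> x = x f\<close> and \<open>\<theta> y = g\<close>, then every
  form \<open>t x + e y\<close> with \<open>e \<noteq> 0\<close> that divides its own derivative divides \<open>y f - g\<close>, which restricts
  to \<open>- g\<close>.\<close>

lemma fiber_prod_dvd:
  assumes finF: "finite F" and a: "lin_form I a dvd dval I \<theta> a"
    and forms: "\<And>X. X \<in> F \<Longrightarrow> defining_form I (c X) X"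
    and dvd: "\<And>X. X \<in> F \<Longrightarrow> lin_form I (c X) dvd dval I \<theta> (c X)"
    and rel: "\<And>X. X \<in> F \<Longrightarrow> \<exists>t. \<forall>j\<in>J. restr_form (c X) j = t * restr_form a j"
    and not_dvd: "\<And>X. X \<in> F \<Longrightarrow> \<not> lin_form I a dvd lin_form I (c X)"
  shows "(\<Prod>X\<in>F. \<sigma> (lin_form I (c X))) dvd \<sigma> (dval I \<theta> \<alpha>)"
proof -
  obtain f where f: "dval I \<theta> a = lin_form I a * f" using a by blast
  define w where "w = lin_form I \<alpha> * f - dval I \<theta> \<alpha>"
  have "lin_form I (c X) dvd w" if X: "X \<in> F" for X
  proof -
    obtain t where t: "\<And>j. j \<in> J \<Longrightarrow> restr_form (c X) j = t * restr_form a j"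
      using rel[OF X] by blast
    define e where "e = c X i0 - t * a i0"
    have "c X i - t * a i = e * \<alpha> i" if "i \<in> I" for i
      using restr_form_eq_0[of "\<lambda>i. c X i - t * a i" i] t that
      by (simp add: restr_form_def e_def algebra_simps)
    then have eq: "c X i = t * a i + e * \<alpha> i" if "i \<in> I" for i
      using that by (simp add: algebra_simps)
    note lf = lin_form_lincomb[where I = I and c = "c X", OF eq]
    note dv = dval_lincomb_form[where I = I and c = "c X" and \<theta> = \<theta>, OF eq]
    \<comment> \<open>Otherwise the form of \<open>c X\<close> would be \<open>t\<close> times that
      of \<open>a\<close>, against \<open>not_dvd\<close>.\<close>
    have "e \<noteq> 0"
      using not_dvd[OF X] by (auto simp: lf)
    have "cst e * w = lin_form I (c X) * f - dval I \<theta> (c X)"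
      by (simp add: w_def lf dv f algebra_simps)
    then have "lin_form I (c X) dvd cst e * w"
      using dvd[OF X] by simp
    then have "lin_form I (c X) dvd cst (inverse e) * (cst e * w)"
      by simp
    then show ?thesis
      by (simp only: cst_inverse_mult[OF \<open>e \<noteq> 0\<close>])
  qed
  note dvd_w = this
  \<comment> \<open>Before restriction, distinct hyperplanes have coprime forms, so the classes are
    singletons.\<close>
  have "(\<Prod>X\<in>F. lin_form I (c X)) dvd w"
  proof (rule grouped_prod_dvd[where r = id])
    show "\<not> lin_form I (c X) dvd lin_form I (c Y)" if "X \<in> F" "Y \<in> F" "id X \<noteq> id Y" for X Y
      using lin_form_dvd_imp_hyperplane_eq[OF fin forms forms] that by auto
    show "(\<Prod>X\<in>{X \<in> F. id X = Y}. lin_form I (c X)) dvd w" for Y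
    proof -
      have "{X \<in> F. id X = Y} = (if Y \<in> F then {Y} else {})" by auto
      then show ?thesis using dvd_w by simp
    qed
  qed (use finF forms prime_elem_defining_form[OF fin] in auto)
  then have "\<sigma> (\<Prod>X\<in>F. lin_form I (c X)) dvd \<sigma> w"
    unfolding \<sigma>_def by (rule subst_dvd)
  moreover have "\<sigma> (lin_form I \<alpha>) = 0"
    using dvd_iff_\<sigma>[of "lin_form I \<alpha>"] by simp
  ultimately show ?thesis
    by (simp add: w_def \<sigma>_simps)
qed

text \<open>Terao's polynomial \<open>p\<close>: one factor for every hyperplane of \<open>A\<close> that is not the chosen
  representative of its restriction.\<close>

lemma restriction_polynomial:
  assumes A: "central_arrangement I A" and "H \<notin> A"
  obtains p where "p \<in> polys J" "p \<noteq> 0" "homogeneous (card A - card (restr_hyp ` A)) p"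
    "\<And>\<theta>. \<theta> \<in> log_derivations I A \<Longrightarrow> p dvd \<sigma> (dval I \<theta> \<alpha>)"
proof -
  have finA: "finite A" using A by (simp add: central_arrangement_def)
  obtain c where c: "\<And>X. X \<in> A \<Longrightarrow> defining_form I (c X) X"
    using A unfolding central_arrangement_def by metis
  have cJ: "defining_form J (restr_form (c X)) (restr_hyp X)" if "X \<in> A" for X
    using that defining_form_restr[OF c[OF that]] \<open>H \<notin> A\<close> by metis
  define C where "C Y = (SOME X. X \<in> A \<and> restr_hyp X = Y)" for Y
  have C: "C Y \<in> A \<and> restr_hyp (C Y) = Y" if "Y \<in> restr_hyp ` A" for Y
    unfolding C_def by (rule someI_ex) (use that in blast)
  define S where "S = A - C ` restr_hyp ` A"
  define p where "p = (\<Prod>X\<in>S. \<sigma> (lin_form I (c X)))"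
  have finS: "finite S" using finA by (simp add: S_def)
  have "inj_on C (restr_hyp ` A)"
    by (rule inj_on_inverseI[where g = restr_hyp]) (use C in blast)
  then have "card (C ` restr_hyp ` A) = card (restr_hyp ` A)"
    by (rule card_image)
  moreover have "C ` restr_hyp ` A \<subseteq> A"
    using C by blast
  ultimately have card: "card S = card A - card (restr_hyp ` A)"
    using finA by (simp add: S_def card_Diff_subset)
  show thesis
  proof (rule that[of p])
    show "p \<in> polys J"
      unfolding p_def by (intro prod_in_polys \<sigma>_in_polys lin_form_in_polys) simp
    show "p \<noteq> 0"
      unfolding p_def mpoly_prod_eq_0_iff[OF finS] \<sigma>_lin_form
      using prime_elem_not_zeroI[OF prime_elem_defining_form[OF finJ cJ]] by (simp add: S_def)
    show "homogeneous (card A - card (restr_hyp ` A)) p"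
      unfolding card[symmetric] p_def \<sigma>_lin_form by (rule homogeneous_prod[OF homogeneous_lin_form finS])
    fix \<theta> assume "\<theta> \<in> log_derivations I A"
    then have \<theta>: "lin_form I (c X) dvd dval I \<theta> (c X)" if "X \<in> A" for X
      using that c log_derivations_iff[OF fin, of A c \<theta>] by blast
    show "p dvd \<sigma> (dval I \<theta> \<alpha>)"
      unfolding p_def
    proof (rule grouped_prod_dvd[OF finS, where r = restr_hyp])
      show "prime_elem (\<sigma> (lin_form I (c X)))" if "X \<in> S" for X
        using that prime_elem_defining_form[OF finJ cJ] by (simp add: S_def \<sigma>_lin_form)
      show "\<not> \<sigma> (lin_form I (c X)) dvd \<sigma> (lin_form I (c Y))"
        if "X \<in> S" "Y \<in> S" "restr_hyp X \<noteq> restr_hyp Y" for X Y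
        using that lin_form_dvd_imp_hyperplane_eq[OF finJ cJ cJ, of X Y] unfolding \<sigma>_lin_form S_def by blast
      fix Y
      let ?F = "{X \<in> S. restr_hyp X = Y}"
      show "(\<Prod>X\<in>?F. \<sigma> (lin_form I (c X))) dvd \<sigma> (dval I \<theta> \<alpha>)"
      proof (cases "?F = {}")
        case False
        then have "Y \<in> restr_hyp ` A" by (auto simp: S_def)
        then have CY: "C Y \<in> A" "restr_hyp (C Y) = Y" "C Y \<notin> S"
          using C by (auto simp: S_def)
        obtain k where k: "k \<in> J" "restr_form (c (C Y)) k \<noteq> 0"
          using cJ[OF CY(1)] by (auto simp: defining_form_def)
        \<comment> \<open>The representative \<open>C Y\<close> plays the role of \<open>a\<close>:
          it lies in \<open>A\<close> but contributes no factor.\<close>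
        show ?thesis
        proof (rule fiber_prod_dvd[of _ "c (C Y)"])
          fix X assume X: "X \<in> ?F"
          then have XA: "X \<in> A" by (simp add: S_def)
          show "defining_form I (c X) X" "lin_form I (c X) dvd dval I \<theta> (c X)"
            using c \<theta> XA by blast+
          have "hyperplane_of J (restr_form (c (C Y))) = hyperplane_of J (restr_form (c X))"
            using cJ[OF XA] cJ[OF CY(1)] X CY(2) by (simp add: defining_form_def)
          then show "\<exists>t. \<forall>j\<in>J. restr_form (c X) j = t * restr_form (c (C Y)) j"
            using hyperplane_of_eq_imp_proportional[where a = "restr_form (c (C Y))", OF finJ k] by blast
          show "\<not> lin_form I (c (C Y)) dvd lin_form I (c X)"
            using lin_form_dvd_imp_hyperplane_eq[OF fin c[OF CY(1)] c[OF XA]] CY X by auto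
        qed (use finS \<theta> CY in auto)
      next
        case True
        show ?thesis unfolding True by simp
      qed
    qed
  qed
qed

end

subsection \<open>The addition theorem\<close>

text \<open>Fraction-free Gaussian elimination: cross-multiplying with the pivot keeps the entries
  in \<open>polys J\<close>, and since there are no zero divisors a nonzero solution for the
  remaining rows stays nonzero.\<close>

lemma dependent_rows:
  fixes m :: "'a \<Rightarrow> 'b \<Rightarrow> ('i, 'k::field) mpoly"
  assumes "finite T" "finite S" "card T < card S" "\<And>s t. s \<in> S \<Longrightarrow> t \<in> T \<Longrightarrow> m s t \<in> polys J"
  shows "\<exists>c. (\<forall>s\<in>S. c s \<in> polys J) \<and> (\<exists>s\<in>S. c s \<noteq> 0) \<and> (\<forall>t\<in>T. (\<Sum>s\<in>S. c s * m s t) = 0)"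
  using assms
proof (induction T arbitrary: S m rule: finite_induct)
  case empty
  then have "S \<noteq> {}" by auto
  then show ?case by (intro exI[of _ "\<lambda>_. 1"]) auto
next
  case (insert t T)
  show ?case
  proof (cases "\<forall>s\<in>S. m s t = 0")
    case True
    have "\<exists>c. (\<forall>s\<in>S. c s \<in> polys J) \<and> (\<exists>s\<in>S. c s \<noteq> 0) \<and> (\<forall>t\<in>T. (\<Sum>s\<in>S. c s * m s t) = 0)"
      using insert.prems insert.hyps by (intro insert.IH) auto
    then show ?thesis using True by auto
  next
    case False
    then obtain s0 where s0: "s0 \<in> S" "m s0 t \<noteq> 0" by blast
    define S' where "S' = S - {s0}"
    define m' where "m' s u = m s0 t * m s u - m s t * m s0 u" for s u
    have S: "S = insert s0 S'" "s0 \<notin> S'" "finite S'"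
      using s0 insert.prems by (auto simp: S'_def)
    have "\<exists>c. (\<forall>s\<in>S'. c s \<in> polys J) \<and> (\<exists>s\<in>S'. c s \<noteq> 0) \<and> (\<forall>t\<in>T. (\<Sum>s\<in>S'. c s * m' s t) = 0)"
    proof (rule insert.IH)
      show "card T < card S'"
        using insert.prems(2) insert.hyps S by simp
      show "m' s u \<in> polys J" if "s \<in> S'" "u \<in> T" for s u
        unfolding m'_def using that S(1) insert.prems(3) by (intro diff_in_polys mult_in_polys) auto
    qed (fact S(3))
    then obtain c where c: "\<And>s. s \<in> S' \<Longrightarrow> c s \<in> polys J" "\<exists>s\<in>S'. c s \<noteq> 0"
      "\<And>u. u \<in> T \<Longrightarrow> (\<Sum>s\<in>S'. c s * m' s u) = 0" by blast
    \<comment> \<open>The coefficient of the pivot row cancels column \<open>t\<close>; in every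
      column the result is the combination of the rows of \<open>m'\<close>.\<close>
    define c' where "c' s = (if s = s0 then - (\<Sum>s\<in>S'. c s * m s t) else c s * m s0 t)" for s
    have sum: "(\<Sum>s\<in>S. c' s * m s u) = (\<Sum>s\<in>S'. c s * m' s u)" for u
    proof -
      have "(\<Sum>s\<in>S'. c' s * m s u) = (\<Sum>s\<in>S'. c s * m s0 t * m s u)"
        using S(2) by (intro sum.cong) (auto simp: c'_def)
      then have "(\<Sum>s\<in>S. c' s * m s u) = (\<Sum>s\<in>S'. c s * m s0 t * m s u) - (\<Sum>s\<in>S'. c s * m s t) * m s0 u"
        using S(2,3) by (simp add: S(1)) (simp add: c'_def)
      then show ?thesis
        by (simp add: m'_def sum_distrib_right sum_subtractf[symmetric] right_diff_distrib mult.assoc)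
    qed
    have "\<forall>s\<in>S. c' s \<in> polys J"
      unfolding c'_def using S c(1) insert.prems(3) s0(1)
      by (auto intro!: uminus_in_polys sum_in_polys mult_in_polys)
    moreover have "\<exists>s\<in>S. c' s \<noteq> 0"
      using c(2) s0(2) S by (auto simp: c'_def mpoly_mult_eq_0_iff)
    moreover have "(\<Sum>s\<in>S. c' s * m s u) = 0" if "u \<in> insert t T" for u
    proof (cases "u = t")
      case True
      then show ?thesis by (simp add: sum m'_def mult.commute)
    next
      case False
      then show ?thesis using that c(3) sum by auto
    qed
    ultimately show ?thesis by blast
  qed
qed

text \<open>Indexed form of \<open>module_basis\<close>. The addition theorem indexes its new basis
  by the old one, and in this form the distinctness of the new members follows from
  independence.\<close>

definition family_basis ::
    "'i set \<Rightarrow> ('i \<Rightarrow> ('i, 'k::field) mpoly) set \<Rightarrow> 'b set \<Rightarrow> ('b \<Rightarrow> 'i \<Rightarrow> ('i, 'k) mpoly) \<Rightarrow> bool" where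
  "family_basis I M B v \<longleftrightarrow> finite B \<and> v ` B \<subseteq> M \<and>
     (\<forall>\<delta>\<in>M. \<exists>c. (\<forall>x\<in>B. c x \<in> polys I) \<and> (\<forall>k. \<delta> k = (\<Sum>x\<in>B. c x * v x k))) \<and>
     (\<forall>c. (\<forall>x\<in>B. c x \<in> polys I) \<and> (\<forall>k. (\<Sum>x\<in>B. c x * v x k) = 0) \<longrightarrow> (\<forall>x\<in>B. c x = 0))"

lemma family_basis_span:
  assumes "family_basis I M B v" "\<delta> \<in> M"
  shows "\<exists>c. (\<forall>x\<in>B. c x \<in> polys I) \<and> (\<forall>k. \<delta> k = (\<Sum>x\<in>B. c x * v x k))"
  using assms by (simp add: family_basis_def)

lemma family_basis_indep:
  assumes "family_basis I M B v" "\<And>x. x \<in> B \<Longrightarrow> c x \<in> polys I"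
    "\<And>k. (\<Sum>x\<in>B. c x * v x k) = 0" "x \<in> B"
  shows "c x = 0"
  using assms by (simp add: family_basis_def)

lemma module_basis_iff_family: "module_basis I M B \<longleftrightarrow> family_basis I M B (\<lambda>\<theta>. \<theta>)"
  by (simp add: module_basis_def family_basis_def)

lemma family_basis_inj:
  assumes "family_basis I M B v" shows "inj_on v B"
proof (rule inj_onI, rule ccontr)
  fix x y assume xy: "x \<in> B" "y \<in> B" "v x = v y" "x \<noteq> y"
  define c :: "_ \<Rightarrow> ('a, 'b) mpoly" where "c z = (if z = x then 1 else if z = y then - 1 else 0)" for z
  have "(\<Sum>z\<in>B. c z * v z k) = 0" for k
  proof -
    have "(\<Sum>z\<in>B. c z * v z k) = (\<Sum>z\<in>{x, y}. c z * v z k)"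
      using assms xy by (intro sum.mono_neutral_right) (auto simp: family_basis_def c_def)
    then show ?thesis using xy by (simp add: c_def)
  qed
  moreover have "c z \<in> polys I" for z
    by (simp add: c_def uminus_in_polys)
  ultimately have "c x = 0"
    using family_basis_indep[OF assms, of c] xy(1) by blast
  then show False by (simp add: c_def)
qed

lemma module_basis_image:
  assumes "family_basis I M B v" shows "module_basis I M (v ` B)"
proof -
  note inj = family_basis_inj[OF assms]
  have "\<exists>c. (\<forall>\<theta>\<in>v ` B. c \<theta> \<in> polys I) \<and> (\<forall>k. \<delta> k = (\<Sum>\<theta>\<in>v ` B. c \<theta> * \<theta> k))" if "\<delta> \<in> M" for \<delta>
  proof -
    obtain c where c: "\<And>x. x \<in> B \<Longrightarrow> c x \<in> polys I" "\<And>k. \<delta> k = (\<Sum>x\<in>B. c x * v x k)"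
      using family_basis_span[OF assms \<open>\<delta> \<in> M\<close>] by blast
    then show ?thesis
      using inj by (intro exI[of _ "\<lambda>\<theta>. c (inv_into B v \<theta>)"]) (simp add: sum.reindex)
  qed
  moreover have "\<forall>\<theta>\<in>v ` B. c \<theta> = 0"
    if "\<forall>\<theta>\<in>v ` B. c \<theta> \<in> polys I" "\<forall>k. (\<Sum>\<theta>\<in>v ` B. c \<theta> * \<theta> k) = 0" for c
  proof -
    have "c (v x) = 0" if "x \<in> B" for x
      using that \<open>\<forall>\<theta>\<in>v ` B. c \<theta> \<in> polys I\<close> \<open>\<forall>k. (\<Sum>\<theta>\<in>v ` B. c \<theta> * \<theta> k) = 0\<close> inj
      by (intro family_basis_indep[OF assms, of "\<lambda>x. c (v x)"]) (auto simp: sum.reindex)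
    then show ?thesis by simp
  qed
  ultimately show ?thesis
    using assms by (simp add: module_basis_def family_basis_def)
qed

lemma has_exponentsI_family:
  assumes "central_arrangement I A" and basis: "family_basis I (log_derivations I A) B v"
    and "\<And>x k. x \<in> B \<Longrightarrow> k \<in> I \<Longrightarrow> homogeneous (d x) (v x k)"
  shows "has_exponents I A (image_mset d (mset_set B))"
proof -
  note inj = family_basis_inj[OF basis]
  have fin: "finite B"
    using basis by (simp add: family_basis_def)
  have "mset_set (v ` B) = image_mset v (mset_set B)"
    by (rule image_mset_mset_set[symmetric, OF inj])
  moreover have "image_mset (\<lambda>x. d (inv_into B v (v x))) (mset_set B) = image_mset d (mset_set B)"
    using inj fin by (intro image_mset_cong) simp
  ultimately have "image_mset d (mset_set B) = image_mset (\<lambda>\<theta>. d (inv_into B v \<theta>)) (mset_set (v ` B))"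
    by (simp add: image_mset.compositionality o_def)
  moreover have "\<forall>\<theta>\<in>v ` B. \<forall>k\<in>I. homogeneous (d (inv_into B v \<theta>)) (\<theta> k)"
    using assms(3) inj by simp
  ultimately show ?thesis
    unfolding has_exponents_def using assms(1) module_basis_image[OF basis]
    by (intro conjI exI[of _ "v ` B"] exI[of _ "\<lambda>\<theta>. d (inv_into B v \<theta>)"]) simp_all
qed

lemma homogeneous_0_imp_cst:
  assumes "homogeneous 0 p" shows "\<exists>c. p = cst c"
proof -
  have "m = 0" if "m \<in> Poly_Mapping.keys p" for m
    using assms that by (auto simp: homogeneous_iff mdeg_def in_keys_iff intro!: poly_mapping_eqI)
  then have "p = cst (Poly_Mapping.lookup p 0)"
    unfolding cst_def
    by (intro poly_mapping_eqI) (auto simp: lookup_single when_def in_keys_iff)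
  then show ?thesis ..
qed

lemma log_derivations_subset: "log_derivations I A \<subseteq> derivations I"
  by (auto simp: log_derivations_def)

lemma dval_homogeneous:
  "(\<And>k. k \<in> I \<Longrightarrow> homogeneous d (\<theta> k)) \<Longrightarrow> homogeneous d (dval I \<theta> a)"
  unfolding dval_def by (intro homogeneous_sum homogeneous_cst_mult)

section \<open>Derivations tangent to \<open>H\<close>\<close>

context elimination
begin

text \<open>Tangency removes the correction term of \<open>\<sigma>_dval\<close>, so each
  divisibility required by \<open>A\<close> restricts to \<open>H\<close>. A restricted hyperplane
  gets its form from a chosen preimage.\<close>

lemma restricted_derivation:
  assumes A: "central_arrangement I A" "H \<notin> A" and \<theta>: "\<theta> \<in> log_derivations I A" "\<sigma> (dval I \<theta> \<alpha>) = 0"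
  shows "(\<lambda>k. if k \<in> J then \<sigma> (\<theta> k) else 0) \<in> log_derivations J (restr_hyp ` A)"
proof -
  obtain f where f: "\<And>X. X \<in> A \<Longrightarrow> defining_form I (f X) X"
    using A unfolding central_arrangement_def by metis
  define C where "C Y = (SOME X. X \<in> A \<and> restr_hyp X = Y)" for Y
  have C: "C Y \<in> A \<and> restr_hyp (C Y) = Y" if "Y \<in> restr_hyp ` A" for Y
    unfolding C_def by (rule someI_ex) (use that in blast)
  have form: "defining_form J (restr_form (f (C Y))) Y" if "Y \<in> restr_hyp ` A" for Y
    using defining_form_restr[OF f, of "C Y"] C[OF that] A(2) by metis
  have \<theta>': "\<theta> \<in> derivations I" "\<And>X. X \<in> A \<Longrightarrow> lin_form I (f X) dvd dval I \<theta> (f X)"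
    using \<theta>(1) log_derivations_iff[OF fin, of A f] f by blast+
  have "lin_form J (restr_form (f X)) dvd dval J (\<lambda>k. if k \<in> J then \<sigma> (\<theta> k) else 0) (restr_form (f X))"
    if "X \<in> A" for X
  proof -
    have "dval J (\<lambda>k. if k \<in> J then \<sigma> (\<theta> k) else 0) (restr_form (f X)) = \<sigma> (dval I \<theta> (f X))"
      using \<sigma>_dval[of \<theta> "f X"] by (simp add: \<theta>(2)) (simp add: dval_def)
    moreover have "\<sigma> (lin_form I (f X)) dvd \<sigma> (dval I \<theta> (f X))"
      unfolding \<sigma>_def by (rule subst_dvd) (rule \<theta>'(2)[OF that])
    ultimately show ?thesis by (simp add: \<sigma>_lin_form)
  qed
  moreover have "(\<lambda>k. if k \<in> J then \<sigma> (\<theta> k) else 0) \<in> derivations J"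
    using \<theta>'(1) by (auto simp: derivations_def mem_I intro: \<sigma>_in_polys)
  ultimately show ?thesis
    using log_derivations_iff[OF finJ form] C by blast
qed

text \<open>The forms of \<open>A\<close> are primes that do not divide the form of
  \<open>H\<close>, so that factor can be cancelled.\<close>

lemma log_derivation_divide:
  assumes A: "central_arrangement I A" "H \<notin> A"
    and \<eta>: "\<eta> \<in> derivations I" and mult: "(\<lambda>k. lin_form I \<alpha> * \<eta> k) \<in> log_derivations I A"
  shows "\<eta> \<in> log_derivations I A"
proof -
  obtain f where f: "\<And>X. X \<in> A \<Longrightarrow> defining_form I (f X) X"
    using A unfolding central_arrangement_def by metis
  have "lin_form I (f X) dvd dval I \<eta> (f X)" if X: "X \<in> A" for X
  proof -
    have "lin_form I (f X) dvd lin_form I \<alpha> * dval I \<eta> (f X)"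
      using mult X log_derivations_iff[OF fin, of A f] f by (simp add: dval_mult)
    moreover have "\<not> lin_form I (f X) dvd lin_form I \<alpha>"
      using lin_form_dvd_imp_hyperplane_eq[OF fin f[OF X] defining_form_\<alpha>] A(2) X by blast
    ultimately show ?thesis
      using prime_elem_dvd_multD[OF prime_elem_defining_form[OF fin f[OF X]]] by blast
  qed
  then show ?thesis
    using log_derivations_iff[OF fin, of A f] f \<eta> by blast
qed

lemma log_derivations_insert:
  assumes A: "central_arrangement I A" "H \<notin> A"
  shows "\<theta> \<in> log_derivations I (insert H A) \<longleftrightarrow> \<theta> \<in> log_derivations I A \<and> \<sigma> (dval I \<theta> \<alpha>) = 0"
proof -
  obtain f where f: "\<And>X. X \<in> A \<Longrightarrow> defining_form I (f X) X"
    using A unfolding central_arrangement_def by metis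
  define g where "g = f(H := \<alpha>)"
  have g: "defining_form I (g X) X" if "X \<in> insert H A" for X
    using that f defining_form_\<alpha> by (auto simp: g_def)
  have gA: "g X = f X" if "X \<in> A" for X
    using that A(2) by (auto simp: g_def)
  have "g H = \<alpha>" by (simp add: g_def)
  then show ?thesis
    using log_derivations_iff[OF fin g, of "insert H A"] log_derivations_iff[OF fin f, of A]
    by (auto simp: gA dvd_iff_\<sigma>)
qed

end

lemma log_derivations_lincomb:
  assumes A: "central_arrangement I A" and c: "\<And>x. x \<in> S \<Longrightarrow> c x \<in> polys I"
    and v: "\<And>x. x \<in> S \<Longrightarrow> v x \<in> log_derivations I A"
  shows "(\<lambda>k. \<Sum>x\<in>S. c x * v x k) \<in> log_derivations I A"
proof -
  obtain f where f: "\<And>X. X \<in> A \<Longrightarrow> defining_form I (f X) X"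
    using A unfolding central_arrangement_def by metis
  have fin: "finite I"
    using A by (simp add: central_arrangement_def)
  have iff: "\<theta> \<in> log_derivations I A \<longleftrightarrow>
      \<theta> \<in> derivations I \<and> (\<forall>X\<in>A. lin_form I (f X) dvd dval I \<theta> (f X))" for \<theta>
    by (rule log_derivations_iff[OF fin f])
  have v': "v x k \<in> polys I" "j \<notin> I \<Longrightarrow> v x j = 0" if "x \<in> S" "k \<in> I" for x k j
    using v[OF that(1)] that(2) by (simp_all add: iff derivations_def)
  have "lin_form I (f X) dvd dval I (\<lambda>k. \<Sum>x\<in>S. c x * v x k) (f X)" if "X \<in> A" for X
    unfolding dval_lincomb using v that by (intro dvd_sum dvd_mult) (simp add: iff)
  moreover have "(\<Sum>x\<in>S. c x * v x k) = 0" if "k \<notin> I" for k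
    using v that by (intro sum.neutral) (simp add: iff derivations_def)
  ultimately show ?thesis
    unfolding iff derivations_def by (auto intro!: sum_in_polys mult_in_polys c v')
qed

context elimination
begin

text \<open>A relation between the restrictions makes all coefficients of \<open>\<delta>\<close>,
  the same combination upstairs, divisible by the form of \<open>H\<close>. The quotient is again
  logarithmic, so it expands in \<open>B\<close>, and independence of \<open>B\<close> makes every
  \<open>c \<theta>\<close> divisible by that form. But \<open>c \<theta>\<close> does not involve
  the variable \<open>i0\<close>, hence it is 0.\<close>

lemma restrictions_independent:
  assumes A: "central_arrangement I A" "H \<notin> A"
    and B: "module_basis I (log_derivations I A) B"
    and S: "S \<subseteq> B" "\<And>\<theta>. \<theta> \<in> S \<Longrightarrow> \<sigma> (dval I \<theta> \<alpha>) = 0"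
    and c: "\<And>\<theta>. \<theta> \<in> S \<Longrightarrow> c \<theta> \<in> polys J" "\<And>k. k \<in> J \<Longrightarrow> (\<Sum>\<theta>\<in>S. c \<theta> * \<sigma> (\<theta> k)) = 0"
    and \<theta>: "\<theta> \<in> S"
  shows "c \<theta> = 0"
proof -
  have finB: "finite B" and B_sub: "\<And>\<theta>. \<theta> \<in> B \<Longrightarrow> \<theta> \<in> log_derivations I A"
    using B unfolding module_basis_def by blast+
  define \<delta> where "\<delta> = (\<lambda>k. \<Sum>\<theta>\<in>S. c \<theta> * \<theta> k)"
  have cI: "c \<theta> \<in> polys I" if "\<theta> \<in> S" for \<theta>
    using c(1)[OF that] polys_mono[OF J_subset] by blast
  have \<sigma>c: "\<sigma> (c \<theta>) = c \<theta>" if "\<theta> \<in> S" for \<theta>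
    using c(1) that \<sigma>_id by blast
  have \<delta>: "\<delta> \<in> log_derivations I A"
    unfolding \<delta>_def using A(1) cI B_sub S(1) by (intro log_derivations_lincomb) auto
  have \<sigma>\<delta>: "\<sigma> (\<delta> k) = 0" if "k \<in> J" for k
    using c(2)[OF that] by (simp add: \<delta>_def \<sigma>_simps \<sigma>c)
  have "\<sigma> (dval I \<delta> \<alpha>) = 0"
    unfolding \<delta>_def dval_lincomb by (simp add: \<sigma>_simps S(2))
  moreover have "dval J (\<lambda>k. \<sigma> (\<delta> k)) a = 0" for a
    by (simp add: dval_def \<sigma>\<delta>)
  ultimately have "\<sigma> (dval I \<delta> a) = 0" for a
    using \<sigma>_dval[of \<delta> a] by simp
  \<comment> \<open>The coordinate form of \<open>i0\<close> picks out the one coefficient of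
    \<open>\<delta>\<close> not indexed by \<open>J\<close>.\<close>
  from this[of "\<lambda>i. if i = i0 then 1 else 0"] have "\<sigma> (\<delta> i0) = 0"
    by (simp add: dval_def sum_I \<sigma>_simps \<sigma>\<delta>)
  with \<sigma>\<delta> have dvd: "lin_form I \<alpha> dvd \<delta> k" if "k \<in> I" for k
    using that unfolding mem_I dvd_iff_\<sigma> by blast
  have \<delta>': "\<delta> k \<in> polys I" "j \<notin> I \<Longrightarrow> \<delta> j = 0" if "k \<in> I" for k j
    using \<delta> that by (simp_all add: log_derivations_def derivations_def)
  have "\<exists>r. r \<in> polys I \<and> \<delta> k = lin_form I \<alpha> * r" if "k \<in> I" for k
    using polys_dvdE[OF dvd[OF that] lin_form_in_polys[OF order_refl] \<delta>'(1)[OF that]] by metis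
  then obtain \<eta>' where \<eta>': "\<And>k. k \<in> I \<Longrightarrow> \<eta>' k \<in> polys I \<and> \<delta> k = lin_form I \<alpha> * \<eta>' k"
    by metis
  define \<eta> where "\<eta> k = (if k \<in> I then \<eta>' k else 0)" for k
  have \<delta>_\<eta>: "\<delta> = (\<lambda>k. lin_form I \<alpha> * \<eta> k)"
    using \<eta>' \<delta>'(2)[OF i0] by (auto simp: \<eta>_def)
  have "\<eta> \<in> derivations I"
    using \<eta>' by (simp add: derivations_def \<eta>_def)
  then have "\<eta> \<in> log_derivations I A"
    using log_derivation_divide[OF A] \<delta> unfolding \<delta>_\<eta> by blast
  then obtain e where e: "\<And>\<theta>. \<theta> \<in> B \<Longrightarrow> e \<theta> \<in> polys I" "\<And>k. \<eta> k = (\<Sum>\<theta>\<in>B. e \<theta> * \<theta> k)"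
    using family_basis_span[OF B[unfolded module_basis_iff_family], of \<eta>] by blast
  define c' where "c' \<theta> = (if \<theta> \<in> S then c \<theta> else 0) - lin_form I \<alpha> * e \<theta>" for \<theta>
  have "(\<Sum>\<theta>\<in>B. c' \<theta> * \<theta> k) = 0" for k
  proof -
    have "(\<Sum>\<theta>\<in>B. (if \<theta> \<in> S then c \<theta> else 0) * \<theta> k) = \<delta> k"
      unfolding \<delta>_def using finB S(1) by (intro sum.mono_neutral_cong_right) auto
    moreover have "(\<Sum>\<theta>\<in>B. lin_form I \<alpha> * e \<theta> * \<theta> k) = \<delta> k"
      by (simp add: \<delta>_\<eta> e(2) sum_distrib_left mult.assoc)
    ultimately show ?thesis
      by (simp add: c'_def left_diff_distrib sum_subtractf)
  qed
  moreover have "c' \<theta> \<in> polys I" if "\<theta> \<in> B" for \<theta>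
    using e(1)[OF that] cI by (auto simp: c'_def intro!: diff_in_polys mult_in_polys lin_form_in_polys uminus_in_polys)
  ultimately have "c' \<theta> = 0"
    using family_basis_indep[OF B[unfolded module_basis_iff_family], of c' \<theta>] \<theta> S(1) by blast
  then have "lin_form I \<alpha> dvd c \<theta>"
    using \<theta> by (simp add: c'_def)
  then show ?thesis
    using \<sigma>c[OF \<theta>] by (simp add: dvd_iff_\<sigma>)
qed

text \<open>In the component of degree \<open>e\<close>, the coefficient of \<open>\<eta>\<close>
  has degree \<open>e - deg \<eta>\<close>, so basis elements of degree above \<open>e\<close> drop
  out.\<close>

lemma restriction_in_low_degree_span:
  assumes A: "central_arrangement I A" "H \<notin> A"
    and \<theta>: "\<theta> \<in> log_derivations I A" "\<sigma> (dval I \<theta> \<alpha>) = 0" "\<And>k. k \<in> I \<Longrightarrow> homogeneous e (\<theta> k)"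
    and B: "module_basis J (log_derivations J (restr_hyp ` A)) B"
    and degB: "\<And>\<eta> k. \<eta> \<in> B \<Longrightarrow> k \<in> J \<Longrightarrow> homogeneous (deg \<eta>) (\<eta> k)"
    and d: "e \<le> d"
  shows "\<exists>m. (\<forall>\<eta>\<in>B. m \<eta> \<in> polys J) \<and> (\<forall>k\<in>J. \<sigma> (\<theta> k) = (\<Sum>\<eta>\<in>{\<eta> \<in> B. deg \<eta> \<le> d}. m \<eta> * \<eta> k))"
proof -
  have finB: "finite B"
    using B by (simp add: module_basis_def)
  obtain c where c: "\<And>\<eta>. \<eta> \<in> B \<Longrightarrow> c \<eta> \<in> polys J"
    "\<And>k. (if k \<in> J then \<sigma> (\<theta> k) else 0) = (\<Sum>\<eta>\<in>B. c \<eta> * \<eta> k)"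
    using family_basis_span[OF B[unfolded module_basis_iff_family] restricted_derivation[OF A \<theta>(1,2)]] by blast
  define m where "m \<eta> = (if deg \<eta> \<le> e then hcomp (e - deg \<eta>) (c \<eta>) else 0)" for \<eta>
  have "\<sigma> (\<theta> k) = (\<Sum>\<eta>\<in>{\<eta> \<in> B. deg \<eta> \<le> d}. m \<eta> * \<eta> k)" if k: "k \<in> J" for k
  proof -
    have "homogeneous e (\<sigma> (\<theta> k))"
      using \<sigma>_homogeneous[OF \<theta>(3)] k J_subset by blast
    then have "\<sigma> (\<theta> k) = hcomp e (\<sigma> (\<theta> k))"
      by (simp add: homogeneous_imp_hcomp)
    also have "\<dots> = hcomp e (\<Sum>\<eta>\<in>B. c \<eta> * \<eta> k)"
      using c(2)[of k] k by simp
    also have "\<dots> = (\<Sum>\<eta>\<in>B. m \<eta> * \<eta> k)"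
      unfolding hcomp_sum by (intro sum.cong refl) (simp add: hcomp_mult[OF degB[OF _ k]] m_def)
    also have "\<dots> = (\<Sum>\<eta>\<in>{\<eta> \<in> B. deg \<eta> \<le> d}. m \<eta> * \<eta> k)"
      using d finB by (intro sum.mono_neutral_right) (auto simp: m_def)
    finally show ?thesis .
  qed
  moreover have "\<forall>\<eta>\<in>B. m \<eta> \<in> polys J"
    using c(1) by (simp add: m_def hcomp_in_polys)
  ultimately show ?thesis by blast
qed

text \<open>Otherwise the restrictions of the basis elements of degree at most \<open>d\<close> would be independent and lie
  in the span of the smaller number of basis elements of degree at most \<open>d\<close> on \<open>H\<close>.\<close>

lemma non_tangent_basis_element:
  assumes A: "central_arrangement I A" "H \<notin> A"
    and B: "module_basis I (log_derivations I A) B"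
    and degB: "\<And>\<theta> k. \<theta> \<in> B \<Longrightarrow> k \<in> I \<Longrightarrow> homogeneous (deg \<theta>) (\<theta> k)"
    and B'': "module_basis J (log_derivations J (restr_hyp ` A)) B''"
    and degB'': "\<And>\<theta> k. \<theta> \<in> B'' \<Longrightarrow> k \<in> J \<Longrightarrow> homogeneous (deg'' \<theta>) (\<theta> k)"
    and card: "card {\<eta> \<in> B''. deg'' \<eta> \<le> d} < card {\<theta> \<in> B. deg \<theta> \<le> d}"
  shows "\<exists>\<theta>\<in>B. deg \<theta> \<le> d \<and> \<sigma> (dval I \<theta> \<alpha>) \<noteq> 0"
proof (rule ccontr)
  assume "\<not> ?thesis"
  then have tangent: "\<sigma> (dval I \<theta> \<alpha>) = 0" if "\<theta> \<in> B" "deg \<theta> \<le> d" for \<theta>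
    using that by blast
  define S where "S = {\<theta> \<in> B. deg \<theta> \<le> d}"
  define T where "T = {\<eta> \<in> B''. deg'' \<eta> \<le> d}"
  have fins: "finite B" "finite B''"
    using B B'' by (simp_all add: module_basis_def)
  have B_sub: "\<theta> \<in> log_derivations I A" if "\<theta> \<in> B" for \<theta>
    using B that unfolding module_basis_def by blast
  have finST: "finite T" "finite S" using fins by (simp_all add: S_def T_def)
  have "\<forall>\<theta>\<in>S. \<exists>m. (\<forall>\<eta>\<in>B''. m \<eta> \<in> polys J) \<and> (\<forall>k\<in>J. \<sigma> (\<theta> k) = (\<Sum>\<eta>\<in>T. m \<eta> * \<eta> k))"
  proof
    fix \<theta> assume \<theta>: "\<theta> \<in> S"
    have \<theta>B: "\<theta> \<in> B" "deg \<theta> \<le> d" using \<theta> by (auto simp: S_def)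
    show "\<exists>m. (\<forall>\<eta>\<in>B''. m \<eta> \<in> polys J) \<and> (\<forall>k\<in>J. \<sigma> (\<theta> k) = (\<Sum>\<eta>\<in>T. m \<eta> * \<eta> k))"
      unfolding T_def
      by (rule restriction_in_low_degree_span[OF A B_sub[OF \<theta>B(1)] tangent[OF \<theta>B] degB[OF \<theta>B(1)] B'' degB'' \<theta>B(2)])
  qed
  from bchoice[OF this] obtain m where m: "\<And>\<theta> \<eta>. \<theta> \<in> S \<Longrightarrow> \<eta> \<in> B'' \<Longrightarrow> m \<theta> \<eta> \<in> polys J"
    "\<And>\<theta> k. \<theta> \<in> S \<Longrightarrow> k \<in> J \<Longrightarrow> \<sigma> (\<theta> k) = (\<Sum>\<eta>\<in>T. m \<theta> \<eta> * \<eta> k)"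
    by blast
  have "\<exists>c. (\<forall>\<theta>\<in>S. c \<theta> \<in> polys J) \<and> (\<exists>\<theta>\<in>S. c \<theta> \<noteq> 0) \<and> (\<forall>\<eta>\<in>T. (\<Sum>\<theta>\<in>S. c \<theta> * m \<theta> \<eta>) = 0)"
  proof (rule dependent_rows[OF finST])
    show "card T < card S" using card by (simp add: S_def T_def)
  qed (simp add: m(1) T_def)
  then obtain c where c: "\<And>\<theta>. \<theta> \<in> S \<Longrightarrow> c \<theta> \<in> polys J" "\<exists>\<theta>\<in>S. c \<theta> \<noteq> 0"
    "\<And>\<eta>. \<eta> \<in> T \<Longrightarrow> (\<Sum>\<theta>\<in>S. c \<theta> * m \<theta> \<eta>) = 0"
    by blast
  have "(\<Sum>\<theta>\<in>S. c \<theta> * \<sigma> (\<theta> k)) = 0" if "k \<in> J" for k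
  proof -
    have "(\<Sum>\<theta>\<in>S. c \<theta> * \<sigma> (\<theta> k)) = (\<Sum>\<theta>\<in>S. \<Sum>\<eta>\<in>T. c \<theta> * m \<theta> \<eta> * \<eta> k)"
      by (intro sum.cong refl) (simp add: m(2) that sum_distrib_left mult.assoc)
    also have "\<dots> = (\<Sum>\<eta>\<in>T. (\<Sum>\<theta>\<in>S. c \<theta> * m \<theta> \<eta>) * \<eta> k)"
      unfolding sum_distrib_right by (rule sum.swap)
    finally show ?thesis by (simp add: c(3))
  qed
  then have "c \<theta> = 0" if "\<theta> \<in> S" for \<theta>
    using restrictions_independent[OF A B, of S c \<theta>] tangent c(1) that by (auto simp: S_def)
  then show False using c(2) by blast
qed

end

lemma size_filter_image_mset_set:
  "finite B \<Longrightarrow> size (filter_mset P (image_mset f (mset_set B))) = card {x \<in> B. P (f x)}"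
  by (simp add: filter_mset_image_mset)

context elimination
begin

text \<open>Some basis element \<open>\<theta>0\<close> of degree \<open>d\<close> is not tangent to
  \<open>H\<close>, and its normal component is a constant multiple of \<open>p\<close>. As
  \<open>p\<close> divides all normal components, subtracting multiples of \<open>\<theta>0\<close>
  makes the other basis elements tangent without changing their degrees. Replacing
  \<open>\<theta>0\<close> by its product with the form of \<open>H\<close> raises the one remaining
  degree.\<close>

theorem addition_exponents:
  assumes A: "central_arrangement I A" "H \<notin> A"
    and exp: "has_exponents I A (E' + {#card A - card (restr_hyp ` A)#})"
    and exp_restr: "has_exponents J (restr_hyp ` A) E'"
  shows "has_exponents I (insert H A) (E' + {#Suc (card A - card (restr_hyp ` A))#})"
proof -
  define d where "d = card A - card (restr_hyp ` A)"
  obtain B deg where B: "module_basis I (log_derivations I A) B"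
    and degB: "\<And>\<theta> k. \<theta> \<in> B \<Longrightarrow> k \<in> I \<Longrightarrow> homogeneous (deg \<theta>) (\<theta> k)"
    and E: "E' + {#d#} = image_mset deg (mset_set B)"
    using exp unfolding has_exponents_def d_def by blast
  obtain B'' deg'' where B'': "module_basis J (log_derivations J (restr_hyp ` A)) B''"
    and degB'': "\<And>\<theta> k. \<theta> \<in> B'' \<Longrightarrow> k \<in> J \<Longrightarrow> homogeneous (deg'' \<theta>) (\<theta> k)"
    and E': "E' = image_mset deg'' (mset_set B'')"
    using exp_restr unfolding has_exponents_def by blast
  obtain p where p: "p \<in> polys J" "p \<noteq> 0" "homogeneous d p"
    "\<And>\<theta>. \<theta> \<in> log_derivations I A \<Longrightarrow> p dvd \<sigma> (dval I \<theta> \<alpha>)"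
    using restriction_polynomial[OF A] unfolding d_def by blast
  have fins: "finite B" "finite B''"
    using B B'' by (simp_all add: module_basis_def)
  have B_sub: "\<theta> \<in> log_derivations I A" if "\<theta> \<in> B" for \<theta>
    using B that unfolding module_basis_def by blast
  have "size (filter_mset (\<lambda>x. x \<le> d) E') < size (filter_mset (\<lambda>x. x \<le> d) (E' + {#d#}))"
    by simp
  then have "card {\<eta> \<in> B''. deg'' \<eta> \<le> d} < card {\<theta> \<in> B. deg \<theta> \<le> d}"
    unfolding E unfolding E' by (simp only: size_filter_image_mset_set fins)
  from non_tangent_basis_element[OF A B degB B'' degB'' this]
  obtain \<theta>0 where \<theta>0: "\<theta>0 \<in> B" "deg \<theta>0 \<le> d" "\<sigma> (dval I \<theta>0 \<alpha>) \<noteq> 0"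
    by blast
  \<comment> \<open>The cofactor of \<open>p\<close> is replaced by its homogeneous part. Below
    degree \<open>d\<close> there is no room for a nonzero multiple of \<open>p\<close>.\<close>
  have "\<exists>s. s \<in> polys J \<and> homogeneous (deg \<theta> - d) s \<and> \<sigma> (dval I \<theta> \<alpha>) = s * p \<and> (deg \<theta> < d \<longrightarrow> s = 0)"
    if \<theta>: "\<theta> \<in> B" for \<theta>
  proof -
    have "\<sigma> (dval I \<theta> \<alpha>) \<in> polys J"
      using B_sub[OF \<theta>] log_derivations_subset by (intro \<sigma>_in_polys dval_in_polys) blast
    with p(4)[OF B_sub[OF \<theta>]] p(1) obtain r where r: "r \<in> polys J" "\<sigma> (dval I \<theta> \<alpha>) = p * r"
      by (rule polys_dvdE)
    define s where "s = (if d \<le> deg \<theta> then hcomp (deg \<theta> - d) r else 0)"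
    have "homogeneous (deg \<theta>) (\<sigma> (dval I \<theta> \<alpha>))"
      by (intro \<sigma>_homogeneous dval_homogeneous degB \<theta>)
    then have "\<sigma> (dval I \<theta> \<alpha>) = hcomp (deg \<theta>) (r * p)"
      using r(2) by (simp add: homogeneous_imp_hcomp mult.commute)
    also have "\<dots> = s * p"
      by (simp add: hcomp_mult[OF p(3)] s_def)
    finally show ?thesis
      using r(1) by (intro exI[of _ s]) (simp add: s_def hcomp_in_polys)
  qed
  then obtain s where s: "\<And>\<theta>. \<theta> \<in> B \<Longrightarrow> s \<theta> \<in> polys J" "\<And>\<theta>. \<theta> \<in> B \<Longrightarrow> homogeneous (deg \<theta> - d) (s \<theta>)"
    "\<And>\<theta>. \<theta> \<in> B \<Longrightarrow> \<sigma> (dval I \<theta> \<alpha>) = s \<theta> * p" "\<And>\<theta>. \<theta> \<in> B \<Longrightarrow> deg \<theta> < d \<Longrightarrow> s \<theta> = 0"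
    by metis
  \<comment> \<open>A nonzero multiple of \<open>p\<close> has degree at least \<open>d\<close>, so
    \<open>\<theta>0\<close> has degree exactly \<open>d\<close> and its cofactor is a
    constant.\<close>
  have "s \<theta>0 \<noteq> 0"
    using \<theta>0(3) s(3)[OF \<theta>0(1)] by auto
  then have deg_\<theta>0: "deg \<theta>0 = d"
    using s(4)[OF \<theta>0(1)] \<theta>0(2) by linarith
  then obtain c where c: "s \<theta>0 = cst c"
    using homogeneous_0_imp_cst s(2)[OF \<theta>0(1)] by (metis diff_self_eq_0)
  with \<open>s \<theta>0 \<noteq> 0\<close> have "c \<noteq> 0" by simp
  define q where "q \<theta> = cst (inverse c) * s \<theta>" for \<theta>
  have q: "q \<theta> * cst c = s \<theta>" "q \<theta> \<in> polys J" "q \<theta> \<in> polys I" "homogeneous (deg \<theta> - d) (q \<theta>)"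
    if "\<theta> \<in> B" for \<theta>
  proof -
    show "q \<theta> * cst c = s \<theta>"
      using cst_inverse_mult[OF \<open>c \<noteq> 0\<close>, of "s \<theta>"] by (simp add: q_def mult_ac)
    show "q \<theta> \<in> polys J" "homogeneous (deg \<theta> - d) (q \<theta>)"
      using s(1,2)[OF that] by (simp_all add: q_def mult_in_polys homogeneous_cst_mult)
    then show "q \<theta> \<in> polys I" using polys_mono[OF J_subset] by blast
  qed
  define v where "v \<theta> = (if \<theta> = \<theta>0 then (\<lambda>k. lin_form I \<alpha> * \<theta>0 k) else (\<lambda>k. \<theta> k - q \<theta> * \<theta>0 k))" for \<theta>
  define deg' where "deg' = deg(\<theta>0 := Suc d)"
  have \<alpha>_poly: "lin_form I \<alpha> \<in> polys I" by (simp add: lin_form_in_polys)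
  have \<sigma>\<alpha>: "\<sigma> (lin_form I \<alpha>) = 0"
    using dvd_iff_\<sigma>[of "lin_form I \<alpha>"] by simp
  have v_tangent: "\<sigma> (dval I (v \<theta>) \<alpha>) = 0" if "\<theta> \<in> B" for \<theta>
  proof (cases "\<theta> = \<theta>0")
    case True
    then show ?thesis by (simp add: v_def dval_mult \<sigma>_simps \<sigma>\<alpha>)
  next
    case False
    have "\<sigma> (dval I (v \<theta>) \<alpha>) = s \<theta> * p - q \<theta> * (cst c * p)"
      using False s(3)[OF that] s(3)[OF \<theta>0(1)] \<sigma>_id[OF q(2)[OF that]]
      by (simp add: v_def dval_diff dval_mult \<sigma>_simps c)
    also have "q \<theta> * (cst c * p) = s \<theta> * p"
      using q(1)[OF that] by (simp flip: mult.assoc)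
    finally show ?thesis by simp
  qed
  have v_mem: "v \<theta> \<in> log_derivations I (insert H A)" if \<theta>: "\<theta> \<in> B" for \<theta>
  proof -
    define cv where "cv \<eta> = (if \<theta> = \<theta>0 then lin_form I \<alpha> else if \<eta> = \<theta> then 1 else - q \<theta>)" for \<eta>
    have "v \<theta> = (\<lambda>k. \<Sum>\<eta>\<in>{\<theta>, \<theta>0}. cv \<eta> * \<eta> k)"
      by (cases "\<theta> = \<theta>0") (simp_all add: v_def cv_def)
    moreover have "(\<lambda>k. \<Sum>\<eta>\<in>{\<theta>, \<theta>0}. cv \<eta> * \<eta> k) \<in> log_derivations I A"
      using \<theta> \<theta>0(1) B_sub q(3) \<alpha>_poly
      by (intro log_derivations_lincomb A(1)) (auto simp: cv_def intro: uminus_in_polys)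
    ultimately show ?thesis
      using v_tangent[OF \<theta>] by (simp add: log_derivations_insert[OF A])
  qed
  define B1 where "B1 = B - {\<theta>0}"
  have B1: "finite B1" "\<theta>0 \<notin> B1" "B = insert \<theta>0 B1"
    using fins \<theta>0(1) by (auto simp: B1_def)
  have v_B1: "v \<theta> = (\<lambda>k. \<theta> k - q \<theta> * \<theta>0 k)" if "\<theta> \<in> B1" for \<theta>
    using that B1(2) by (auto simp: v_def)
  have v_\<theta>0: "v \<theta>0 = (\<lambda>k. lin_form I \<alpha> * \<theta>0 k)"
    by (simp add: v_def)
  \<comment> \<open>Translates between the two bases, for spanning as well as for
    independence.\<close>
  have expand: "(\<Sum>\<theta>\<in>B. e \<theta> * \<theta> k) =
      (\<Sum>\<theta>\<in>B1. e \<theta> * v \<theta> k) + (e \<theta>0 + (\<Sum>\<theta>\<in>B1. e \<theta> * q \<theta>)) * \<theta>0 k" for e k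
  proof -
    have "(\<Sum>\<theta>\<in>B1. e \<theta> * \<theta> k) = (\<Sum>\<theta>\<in>B1. e \<theta> * v \<theta> k) + (\<Sum>\<theta>\<in>B1. e \<theta> * q \<theta>) * \<theta>0 k"
      unfolding sum_distrib_right sum.distrib[symmetric]
      by (intro sum.cong refl) (simp add: v_B1 algebra_simps)
    then show ?thesis using B1 by (simp add: distrib_right)
  qed
  have span: "\<exists>e'. (\<forall>\<theta>\<in>B. e' \<theta> \<in> polys I) \<and> (\<forall>k. \<delta> k = (\<Sum>\<theta>\<in>B. e' \<theta> * v \<theta> k))"
    if \<delta>: "\<delta> \<in> log_derivations I (insert H A)" for \<delta>
  proof -
    have \<delta>': "\<delta> \<in> log_derivations I A" "\<sigma> (dval I \<delta> \<alpha>) = 0"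
      using \<delta> by (simp_all add: log_derivations_insert[OF A])
    obtain e where e: "\<And>\<theta>. \<theta> \<in> B \<Longrightarrow> e \<theta> \<in> polys I" "\<And>k. \<delta> k = (\<Sum>\<theta>\<in>B. e \<theta> * \<theta> k)"
      using family_basis_span[OF B[unfolded module_basis_iff_family] \<delta>'(1)] by blast
    define t where "t = e \<theta>0 + (\<Sum>\<theta>\<in>B1. e \<theta> * q \<theta>)"
    have t: "t \<in> polys I"
      unfolding t_def using e(1) q(3) B1(3) by (intro add_in_polys sum_in_polys mult_in_polys) auto
    have \<delta>_eq: "\<delta> k = (\<Sum>\<theta>\<in>B1. e \<theta> * v \<theta> k) + t * \<theta>0 k" for k
      unfolding e(2) expand t_def ..
    have "dval I \<delta> \<alpha> = dval I (\<lambda>k. \<Sum>\<theta>\<in>B1. e \<theta> * v \<theta> k) \<alpha> + dval I (\<lambda>k. t * \<theta>0 k) \<alpha>"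
      by (simp add: dval_def \<delta>_eq distrib_left sum.distrib)
    then have "dval I \<delta> \<alpha> = (\<Sum>\<theta>\<in>B1. e \<theta> * dval I (v \<theta>) \<alpha>) + t * dval I \<theta>0 \<alpha>"
      by (simp only: dval_lincomb dval_mult)
    moreover have "\<sigma> (\<Sum>\<theta>\<in>B1. e \<theta> * dval I (v \<theta>) \<alpha>) = 0"
      using B1(3) by (simp add: \<sigma>_simps v_tangent)
    \<comment> \<open>The other terms are tangent and \<open>\<theta>0\<close> is not, so its
      coefficient vanishes on \<open>H\<close> and supplies the factor by which
      \<open>v \<theta>0\<close> differs from \<open>\<theta>0\<close>.\<close>
    ultimately have "\<sigma> t * \<sigma> (dval I \<theta>0 \<alpha>) = 0"
      using \<delta>'(2) by (simp add: \<sigma>_simps)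
    then have "lin_form I \<alpha> dvd t"
      using \<theta>0(3) by (simp add: dvd_iff_\<sigma> mpoly_mult_eq_0_iff)
    then obtain r where r: "r \<in> polys I" "t = lin_form I \<alpha> * r"
      using polys_dvdE[OF _ \<alpha>_poly t] by blast
    have "\<delta> k = (\<Sum>\<theta>\<in>B. (e(\<theta>0 := r)) \<theta> * v \<theta> k)" for k
    proof -
      have "(\<Sum>\<theta>\<in>B1. (e(\<theta>0 := r)) \<theta> * v \<theta> k) = (\<Sum>\<theta>\<in>B1. e \<theta> * v \<theta> k)"
        using B1(2) by (intro sum.cong) auto
      then show ?thesis
        unfolding \<delta>_eq r(2) B1(3) sum.insert[OF B1(1,2)] by (simp add: v_\<theta>0 mult_ac)
    qed
    then show ?thesis
      using e(1) r(1) by (intro exI[of _ "e(\<theta>0 := r)"]) simp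
  qed
  have indep: "\<forall>\<theta>\<in>B. e \<theta> = 0"
    if e: "\<forall>\<theta>\<in>B. e \<theta> \<in> polys I" and e0: "\<forall>k. (\<Sum>\<theta>\<in>B. e \<theta> * v \<theta> k) = 0" for e
  proof -
    \<comment> \<open>The coefficients of the same combination in the old basis.\<close>
    define u where "u = e(\<theta>0 := lin_form I \<alpha> * e \<theta>0 - (\<Sum>\<theta>\<in>B1. e \<theta> * q \<theta>))"
    have u_B1: "u \<theta> = e \<theta>" if "\<theta> \<in> B1" for \<theta>
      using that B1(2) by (auto simp: u_def)
    have "(\<Sum>\<theta>\<in>B. u \<theta> * \<theta> k) = (\<Sum>\<theta>\<in>B. e \<theta> * v \<theta> k)" for k
    proof -
      have "(\<Sum>\<theta>\<in>B1. u \<theta> * q \<theta>) = (\<Sum>\<theta>\<in>B1. e \<theta> * q \<theta>)" "(\<Sum>\<theta>\<in>B1. u \<theta> * v \<theta> k) = (\<Sum>\<theta>\<in>B1. e \<theta> * v \<theta> k)"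
        by (simp_all add: u_B1)
      then show ?thesis
        unfolding expand using B1(1,2) by (simp add: B1(3)) (simp add: u_def v_\<theta>0 mult_ac)
    qed
    moreover have "u \<theta> \<in> polys I" if "\<theta> \<in> B" for \<theta>
    proof -
      have "lin_form I \<alpha> * e \<theta>0 - (\<Sum>\<theta>\<in>B1. e \<theta> * q \<theta>) \<in> polys I"
        using e q(3) B1(3) by (intro diff_in_polys sum_in_polys mult_in_polys \<alpha>_poly) auto
      then show ?thesis using e that by (simp add: u_def)
    qed
    ultimately have u0: "u \<theta> = 0" if "\<theta> \<in> B" for \<theta>
      using family_basis_indep[OF B[unfolded module_basis_iff_family], of u \<theta>] e0 that by simp
    have e_B1: "e \<theta> = 0" if "\<theta> \<in> B1" for \<theta>
      using u0[of \<theta>] u_B1 that B1(3) by simp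
    then have "lin_form I \<alpha> * e \<theta>0 = 0"
      using u0[OF \<theta>0(1)] by (simp add: u_def)
    then have "e \<theta>0 = 0"
      using prime_elem_not_zeroI[OF prime_elem_defining_form[OF fin defining_form_\<alpha>]]
      by (simp add: mpoly_mult_eq_0_iff)
    with e_B1 show ?thesis by (simp add: B1(3))
  qed
  have "family_basis I (log_derivations I (insert H A)) B v"
    unfolding family_basis_def using fins(1) v_mem span indep by blast
  moreover have "central_arrangement I (insert H A)"
    using A(1) defining_form_\<alpha> by (auto simp: central_arrangement_def)
  moreover have "homogeneous (deg' \<theta>) (v \<theta> k)" if "\<theta> \<in> B" "k \<in> I" for \<theta> k
  proof (cases "\<theta> = \<theta>0")
    case True
    then show ?thesis
      using homogeneous_mult[OF homogeneous_lin_form degB[OF \<theta>0(1) that(2)], of I \<alpha>]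
      by (simp add: deg'_def v_\<theta>0 deg_\<theta>0)
  next
    case False
    \<comment> \<open>Subtraction is truncated: for \<open>deg \<theta> < d\<close> the degrees
      would not add up to \<open>deg \<theta>\<close>, but there the cofactor is 0.\<close>
    have "homogeneous (deg \<theta>) (q \<theta> * \<theta>0 k)"
    proof (cases "deg \<theta> < d")
      case True
      then show ?thesis using s(4)[OF that(1)] by (simp add: q_def)
    next
      case False
      then show ?thesis
        using homogeneous_mult[OF q(4)[OF that(1)] degB[OF \<theta>0(1) that(2)]] by (simp add: deg_\<theta>0)
    qed
    then show ?thesis
      using False degB[OF that] by (simp add: deg'_def v_def homogeneous_diff)
  qed
  ultimately have "has_exponents I (insert H A) (image_mset deg' (mset_set B))"
    by (intro has_exponentsI_family)
  moreover have "image_mset deg' (mset_set B) = E' + {#Suc d#}"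
  proof -
    have "image_mset deg' (mset_set B1) = image_mset deg (mset_set B1)"
      using B1(1,2) by (intro image_mset_cong) (auto simp: deg'_def)
    moreover have "E' = image_mset deg (mset_set B1)"
      using E B1(1,2) by (simp add: B1(3) deg_\<theta>0)
    ultimately show ?thesis
      using B1(1,2) by (simp add: B1(3)) (simp add: deg'_def)
  qed
  ultimately show ?thesis by (simp add: d_def)
qed

end

subsection \<open>Inductive freeness with exponents\<close>

text \<open>The last conjunct is automatic for free arrangements; carrying it along identifies the exponent
  that grows in an addition without counting hyperplanes.\<close>

definition ind_free_exp :: "'i set \<Rightarrow> ('i \<Rightarrow> 'k::field) set set \<Rightarrow> nat multiset \<Rightarrow> bool" where
  "ind_free_exp I A E \<longleftrightarrow> inductively_free I A \<and> has_exponents I A E \<and> sum_mset E = card A"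

lemma ind_free_exp_empty:
  assumes "finite I"
  shows "ind_free_exp I ({} :: ('i \<Rightarrow> 'k::field) set set) (replicate_mset (card I) 0)"
proof -
  define v :: "'i \<Rightarrow> 'i \<Rightarrow> ('i, 'k) mpoly" where "v i k = (if k = i then 1 else 0)" for i k
  have sum_v: "(\<Sum>i\<in>I. c i * v i k) = (if k \<in> I then c k else 0)" for c k
    using assms by (simp add: v_def if_distrib cong: if_cong)
  have log: "log_derivations I ({} :: ('i \<Rightarrow> 'k) set set) = derivations I"
    by (simp add: log_derivations_def)
  have "family_basis I (log_derivations I {}) I v"
    unfolding family_basis_def log
  proof (intro conjI ballI allI impI)
    show "v ` I \<subseteq> derivations I"
      by (auto simp: derivations_def v_def)
    show "\<exists>c. (\<forall>x\<in>I. c x \<in> polys I) \<and> (\<forall>k. \<delta> k = (\<Sum>x\<in>I. c x * v x k))" if "\<delta> \<in> derivations I" for \<delta>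
      using that by (intro exI[of _ \<delta>]) (auto simp: sum_v derivations_def)
    show "c x = 0" if "(\<forall>x\<in>I. c x \<in> polys I) \<and> (\<forall>k. (\<Sum>x\<in>I. c x * v x k) = 0)" "x \<in> I" for c x
      using that by (auto simp: sum_v dest: spec[of _ x])
  qed (fact assms)
  then have "has_exponents I ({} :: ('i \<Rightarrow> 'k) set set) (image_mset (\<lambda>_. 0) (mset_set I))"
    using assms by (rule_tac has_exponentsI_family) (auto simp: central_arrangement_def v_def)
  then show ?thesis
    using assms by (simp add: ind_free_exp_def inductively_free.empty image_mset_const_eq)
qed

lemma (in elimination) ind_free_exp_insert:
  assumes "H \<notin> A" and A: "ind_free_exp I A (E' + {#d#})" and A'': "ind_free_exp J (restr_hyp ` A) E'"
  shows "ind_free_exp I (insert H A) (E' + {#Suc d#})"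
proof -
  \<comment> \<open>The exponents of \<open>A\<close> sum to \<open>card A\<close> and
    \<open>E'\<close> sums to the number of restricted hyperplanes; \<open>d\<close> is the
    difference.\<close>
  have d: "d = card A - card (restr_hyp ` A)"
    using A A'' by (auto simp: ind_free_exp_def)
  have central: "central_arrangement I A"
    using A by (simp add: ind_free_exp_def has_exponents_def)
  have exp: "has_exponents I (insert H A) (E' + {#Suc d#})"
    unfolding d by (rule addition_exponents) (use assms central in \<open>simp_all add: ind_free_exp_def flip: d\<close>)
  have pb: "pullback J \<phi> (restriction (insert H A) H) = restr_hyp ` A"
    using \<open>H \<notin> A\<close> by (simp add: pullback_restriction)
  have "inductively_free I (insert H A)"
  proof (rule inductively_free.add[where H = H and J = J and \<phi> = \<phi> and E' = E' and E = "E' + {#d#}"])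
    show "central_arrangement I (insert H A)"
      using exp by (simp add: has_exponents_def)
  qed (use assms pb \<phi>_linear_coordinates in \<open>simp_all add: ind_free_exp_def\<close>)
  moreover have "finite A"
    using central by (simp add: central_arrangement_def)
  ultimately show ?thesis
    using exp A \<open>H \<notin> A\<close> by (simp add: ind_free_exp_def)
qed

subsection \<open>Cones with a set of active vertices\<close>

definition cone_of_triples :: "'v set \<Rightarrow> ('v \<times> 'v \<times> int) set \<Rightarrow> ('v option \<Rightarrow> 'k::field) set set" where
  "cone_of_triples V R = insert (hyp_at_infinity V) ((\<lambda>(i, j, c). cone_hyp V i j c) ` R)"

definition triples :: "'v set \<Rightarrow> ('v \<Rightarrow> nat) \<Rightarrow> ('v \<times> 'v \<times> int) set" where
  "triples W n = {(i, j, c). i \<in> W \<and> j \<in> W \<and> i \<noteq> j \<and> - int (n i) \<le> c \<and> c \<le> int (n j)}"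

text \<open>An intermediate stage of raising the parameter of \<open>v\<close>: it has its own upper
  bound \<open>u j\<close> for each neighbour, and hyperplanes at \<open>v\<close> are listed only
  with \<open>v\<close> second. The bounds are integers so that -1 can occur: with
  \<open>n j = 0\<close> it leaves no hyperplane between \<open>j\<close> and
  \<open>v\<close>.\<close>

definition star_triples :: "'v set \<Rightarrow> ('v \<Rightarrow> nat) \<Rightarrow> 'v \<Rightarrow> ('v \<Rightarrow> int) \<Rightarrow> ('v \<times> 'v \<times> int) set" where
  "star_triples W n v u = triples (W - {v}) n \<union> {(j, w, c). j \<in> W - {v} \<and> w = v \<and> - int (n j) \<le> c \<and> c \<le> u j}"

lemma cone_hyp_swap: "cone_hyp V i j c = cone_hyp V j i (- c)"
proof -
  have "y (Some i) - y (Some j) = of_int c * y None \<longleftrightarrow> y (Some j) - y (Some i) = of_int (- c) * y None"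
    for y :: "'a option \<Rightarrow> 'b"
    by (auto simp: algebra_simps)
  then show ?thesis by (simp add: cone_hyp_def)
qed

text \<open>\<open>triples\<close> lists every hyperplane in both orientations and
  \<open>star_triples\<close> those at \<open>v\<close> in one only, so the index sets differ while
  the hyperplanes agree.\<close>

lemma cone_of_star_triples:
  assumes "v \<in> W" "\<And>j. j \<in> W - {v} \<Longrightarrow> u j = int (n v)"
  shows "cone_of_triples V (star_triples W n v u) =
    (cone_of_triples V (triples W n) :: ('v option \<Rightarrow> 'k::field) set set)"
proof -
  let ?h = "\<lambda>(i, j, c). cone_hyp V i j c :: ('v option \<Rightarrow> 'k) set"
  have "?h ` triples W n \<subseteq> ?h ` star_triples W n v u"
  proof
    fix X assume "X \<in> ?h ` triples W n"
    then obtain i j c where X: "X = cone_hyp V i j c" and ijc: "(i, j, c) \<in> triples W n" by auto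
    show "X \<in> ?h ` star_triples W n v u"
    proof (cases "i = v")
      case True
      then have "(j, v, - c) \<in> star_triples W n v u"
        using ijc assms by (auto simp: star_triples_def triples_def)
      then show ?thesis
        unfolding X True cone_hyp_swap[of V v j c] by (rule rev_image_eqI) simp
    next
      case False
      then have "(i, j, c) \<in> star_triples W n v u"
        using ijc assms by (auto simp: star_triples_def triples_def)
      then show ?thesis
        unfolding X by (rule rev_image_eqI) simp
    qed
  qed
  moreover have "star_triples W n v u \<subseteq> triples W n"
    using assms by (auto simp: star_triples_def triples_def)
  ultimately have "?h ` triples W n = ?h ` star_triples W n v u"
    by blast
  then show ?thesis by (simp add: cone_of_triples_def)
qed

lemma star_triples_cong:
  assumes "\<And>j. j \<in> W - {v} \<Longrightarrow> n j = n' j" "\<And>j. j \<in> W - {v} \<Longrightarrow> u j = u' j"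
  shows "star_triples W n v u = star_triples W n' v u'"
  using assms by (auto simp: star_triples_def triples_def)

text \<open>The first equation has a solution \<open>f\<close> supported at \<open>i\<close>, and it
  survives adding any function with equal values at \<open>i\<close> and \<open>j\<close>. The
  second must allow the same shifts, which makes the unordered pairs agree. Evaluating at
  \<open>f\<close> then compares the constants, by injectivity of \<open>of_int\<close> in
  characteristic zero.\<close>

lemma difference_eq_inj:
  fixes c c' :: int
  assumes eq: "\<And>a :: 'v \<Rightarrow> 'k::field_char_0. a i - a j = of_int c \<longleftrightarrow> a i' - a j' = of_int c'"
    and ne: "i \<noteq> j" "i' \<noteq> j'"
  shows "i' = i \<and> j' = j \<and> c' = c \<or> i' = j \<and> j' = i \<and> c' = - c"
proof -
  define f where "f k = (if k = i then of_int c else 0 :: 'k)" for k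
  have f: "f i' - f j' = of_int c'"
    using eq[of f] ne by (simp add: f_def)
  have shift: "g i' = g j'" if "g i = g j" for g :: "'v \<Rightarrow> 'k"
  proof -
    have "f i' + g i' - (f j' + g j') = of_int c'"
      using eq[of "\<lambda>k. f k + g k"] ne that by (simp add: f_def)
    then have "f i' - f j' + (g i' - g j') = of_int c'"
      by (simp add: algebra_simps)
    then show ?thesis by (simp add: f)
  qed
  have "(i' = i \<or> i' = j) = (j' = i \<or> j' = j)"
    using shift[of "\<lambda>k. if k = i \<or> k = j then 1 else 0"] by (auto split: if_splits)
  moreover have "i' = i \<or> i' = j"
    using shift[of "\<lambda>k. if k = i' then 1 else 0"] ne by (cases "i' = i"; cases "i' = j") auto
  ultimately have "i' = i \<and> j' = j \<or> i' = j \<and> j' = i"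
    using ne by auto
  then show ?thesis
  proof
    assume "i' = i \<and> j' = j"
    then show ?thesis using f ne by (simp add: f_def)
  next
    assume *: "i' = j \<and> j' = i"
    then have "of_int (- c) = (of_int c' :: 'k)"
      using f ne by (simp add: f_def)
    then show ?thesis using * of_int_eq_iff by metis
  qed
qed

lemma affine_hyp_eqD:
  assumes "(affine_hyp V i j c :: ('v \<Rightarrow> 'k::field_char_0) set) = affine_hyp V i' j' c'"
    and "i \<in> V" "j \<in> V" "i' \<in> V" "j' \<in> V" "i \<noteq> j" "i' \<noteq> j'"
  shows "i' = i \<and> j' = j \<and> c' = c \<or> i' = j \<and> j' = i \<and> c' = - c"
proof (rule difference_eq_inj[where 'k = 'k])
  fix a :: "'v \<Rightarrow> 'k"
  have "(\<lambda>k. if k \<in> V then a k else 0) \<in> affine_hyp V i j c \<longleftrightarrow> (\<lambda>k. if k \<in> V then a k else 0) \<in> affine_hyp V i' j' c'"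
    using assms(1) by simp
  then show "a i - a j = of_int c \<longleftrightarrow> a i' - a j' = of_int c'"
    using assms(2-5) by (simp add: affine_hyp_def coord_space_def)
qed fact+

lemma cone_hyp_eqD:
  assumes "(cone_hyp V i j c :: ('v option \<Rightarrow> 'k::field_char_0) set) = cone_hyp V i' j' c'"
    and "i \<in> V" "j \<in> V" "i' \<in> V" "j' \<in> V" "i \<noteq> j" "i' \<noteq> j'"
  shows "i' = i \<and> j' = j \<and> c' = c \<or> i' = j \<and> j' = i \<and> c' = - c"
proof (rule difference_eq_inj[where 'k = 'k])
  fix a :: "'v \<Rightarrow> 'k"
  \<comment> \<open>Points with \<open>z = 1\<close> reduce the claim to affine equations.\<close>
  define y where "y = (\<lambda>k. case k of None \<Rightarrow> 1 | Some k \<Rightarrow> if k \<in> V then a k else 0)"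
  have "y \<in> coord_space (cone_index V)"
    by (auto simp: y_def coord_space_def cone_index_def split: option.splits)
  moreover have "y \<in> cone_hyp V i j c \<longleftrightarrow> y \<in> cone_hyp V i' j' c'"
    using assms(1) by simp
  ultimately show "a i - a j = of_int c \<longleftrightarrow> a i' - a j' = of_int c'"
    using assms(2-5) by (simp add: cone_hyp_def y_def)
qed fact+

lemma cone_hyp_neq_infinity:
  assumes "i \<in> V" "j \<in> V" "i \<noteq> j"
  shows "(cone_hyp V i j c :: ('v option \<Rightarrow> 'k::field) set) \<noteq> hyp_at_infinity V"
proof
  assume eq: "(cone_hyp V i j c :: ('v option \<Rightarrow> 'k::field) set) = hyp_at_infinity V"
  define y :: "'v option \<Rightarrow> 'k" where "y k = (if k = Some i then 1 else 0)" for k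
  have "y \<in> hyp_at_infinity V"
    using assms by (auto simp: hyp_at_infinity_def y_def coord_space_def cone_index_def)
  then have "y \<in> cone_hyp V i j c"
    using eq by simp
  then show False
    using assms by (simp add: cone_hyp_def y_def)
qed

lemma cone_hyp_notin_star:
  assumes "W \<subseteq> V" "v \<in> W" "i \<in> W - {v}" "u i < m"
  shows "(cone_hyp V i v m :: ('v option \<Rightarrow> 'k::field_char_0) set) \<notin> cone_of_triples V (star_triples W n v u)"
proof
  assume "cone_hyp V i v m \<in> (cone_of_triples V (star_triples W n v u) :: ('v option \<Rightarrow> 'k) set set)"
  moreover have "(cone_hyp V i v m :: ('v option \<Rightarrow> 'k) set) \<noteq> hyp_at_infinity V"
    using assms by (intro cone_hyp_neq_infinity) auto
  ultimately obtain i' j' c' where *: "(i', j', c') \<in> star_triples W n v u"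
    "(cone_hyp V i v m :: ('v option \<Rightarrow> 'k) set) = cone_hyp V i' j' c'"
    by (auto simp: cone_of_triples_def)
  have "i' \<in> V" "j' \<in> V" "i' \<noteq> j'" "i' \<noteq> v"
    using *(1) assms by (auto simp: star_triples_def triples_def)
  \<comment> \<open>The swapped alternative would put \<open>v\<close> first, which
    \<open>star_triples\<close> excludes.\<close>
  with cone_hyp_eqD[OF *(2)] have "i' = i \<and> j' = v \<and> c' = m"
    using assms by auto
  then show False
    using *(1) assms by (auto simp: star_triples_def triples_def)
qed

text \<open>On the hyperplane \<open>x\<^sub>i = x\<^sub>v + m z\<close> the forbidden intervals of \<open>i\<close> and \<open>v\<close> overlap or are
  adjacent, so they merge to a single interval, whether or not \<open>x\<^sub>j = x\<^sub>v + m z\<close> is present for the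
  other vertices \<open>j\<close>.\<close>

lemma ind_free_exp_star_step:
  fixes V :: "'v set" and m :: nat
  assumes V: "finite V" "W \<subseteq> V" "v \<in> W" "i \<in> W - {v}"
    and u: "u i = int m - 1" "\<And>j. j \<in> W - {v} \<Longrightarrow> int m - 1 \<le> u j \<and> u j \<le> int m"
    and A: "ind_free_exp (cone_index V)
      (cone_of_triples V (star_triples W n v u) :: ('v option \<Rightarrow> 'k::field_char_0) set set) (E' + {#d#})"
    and A'': "ind_free_exp (cone_index (V - {i}))
      (cone_of_triples (V - {i}) (triples (W - {i}) (n(v := n i + m))) :: ('v option \<Rightarrow> 'k) set set) E'"
  shows "ind_free_exp (cone_index V)
      (cone_of_triples V (star_triples W n v (u(i := int m))) :: ('v option \<Rightarrow> 'k) set set) (E' + {#Suc d#})"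
proof -
  \<comment> \<open>The hyperplane x_i = x_v + m z, solved for x_i.\<close>
  let ?b = "\<lambda>k. if k = Some v then 1 else if k = None then of_nat m else 0 :: 'k"
  interpret elimination "cone_index V" "Some i" ?b
    using V by unfold_locales (auto simp: cone_index_def)
  let ?V = "V - {i}" and ?W = "W - {i}"
  have "v \<noteq> i" using V by auto
  have J: "J = cone_index ?V"
    unfolding J_def unfolding cone_index_def by auto
  have sum_b: "(\<Sum>k\<in>J. ?b k * x k) = x (Some v) + of_nat m * x None" for x :: "'v option \<Rightarrow> 'k"
  proof -
    have "(\<Sum>k\<in>J. ?b k * x k) = (\<Sum>k\<in>{Some v, None}. ?b k * x k)"
      unfolding J using V by (intro sum.mono_neutral_right) (auto simp: cone_index_def)
    then show ?thesis by simp
  qed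
  have H: "H = cone_hyp V i v (int m)"
    unfolding set_eq_iff mem_H sum_b by (auto simp: cone_hyp_def algebra_simps)
  have \<phi>: "\<phi> x k = (if k = Some i then x (Some v) + of_nat m * x None else x k)" for x k
    by (simp only: \<phi>_def sum_b)
  have restr: "x \<in> restr_hyp X \<longleftrightarrow> x \<in> coord_space (cone_index ?V) \<and> \<phi> x \<in> X" for x X
    by (simp add: restr_hyp_def J)
  have coord: "\<phi> x \<in> coord_space (cone_index V)" if "x \<in> coord_space (cone_index ?V)" for x
    using \<phi>_in_H that mem_H unfolding J by blast
  have r_inf: "restr_hyp (hyp_at_infinity V) = hyp_at_infinity ?V"
    using coord by (auto simp: set_eq_iff restr hyp_at_infinity_def \<phi>)
  have r1: "restr_hyp (cone_hyp V a b c) = cone_hyp ?V a b c" if "a \<noteq> i" "b \<noteq> i" for a b c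
    using coord that by (auto simp: set_eq_iff restr cone_hyp_def \<phi>)
  have r3: "restr_hyp (cone_hyp V a i c) = cone_hyp ?V a v (c + int m)" if "a \<noteq> i" for a c
    using coord that by (auto simp: set_eq_iff restr cone_hyp_def \<phi> algebra_simps)
  have r2: "restr_hyp (cone_hyp V i b c) = cone_hyp ?V b v (int m - c)" if "b \<noteq> i" for b c
    unfolding cone_hyp_swap[of V i b c] r3[OF that] by simp
  \<comment> \<open>The hyperplanes between \<open>i\<close> and \<open>v\<close> already present
    are parallel to \<open>H\<close>, so their trace is the hyperplane at infinity.\<close>
  have vv: "(cone_hyp ?V v v c :: ('v option \<Rightarrow> 'k) set) = hyp_at_infinity ?V" if "c \<noteq> 0" for c
    using that by (simp add: cone_hyp_def hyp_at_infinity_def)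
  let ?R = "star_triples W n v u" and ?R' = "star_triples ?W n v (\<lambda>_. int (n i) + int m)"
  have "restr_hyp ` cone_of_triples V ?R = cone_of_triples ?V ?R'"
  proof (intro equalityI subsetI)
    fix Y assume "Y \<in> restr_hyp ` cone_of_triples V ?R"
    then consider "Y = restr_hyp (hyp_at_infinity V)"
      | a b c where "(a, b, c) \<in> ?R" "Y = restr_hyp (cone_hyp V a b c)"
      by (auto simp: cone_of_triples_def)
    then show "Y \<in> cone_of_triples ?V ?R'"
    proof cases
      case 1
      then show ?thesis by (simp add: r_inf cone_of_triples_def)
    next
      case (2 a b c)
      note R = 2(1) and Y = 2(2)
      have mem: "cone_hyp ?V a' b' c' \<in> cone_of_triples ?V ?R'" if "(a', b', c') \<in> ?R'" for a' b' c'
        using that by (force simp: cone_of_triples_def)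
      consider "a = i" "b = v" | "a = i" "b \<noteq> v" "b \<noteq> i" | "a \<noteq> i" "b = i" | "a \<noteq> i" "b \<noteq> i"
        using R by (auto simp: star_triples_def triples_def)
      then show ?thesis
      proof cases
        case 1
        then have "c \<noteq> int m"
          using R u by (auto simp: star_triples_def triples_def)
        then show ?thesis
          using 1 \<open>v \<noteq> i\<close> by (simp add: Y r2 vv cone_of_triples_def)
      next
        case eq: 2
        then have "(b, v, int m - c) \<in> ?R'"
          using R by (auto simp: star_triples_def triples_def)
        then show ?thesis
          using eq by (simp add: Y r2 mem)
      next
        case 3
        then have "(a, v, c + int m) \<in> ?R'"
          using R V by (auto simp: star_triples_def triples_def)
        then show ?thesis
          using 3 by (simp add: Y r3 mem)
      next
        case 4
        then have "(a, b, c) \<in> ?R'"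
          using R u(2)[of a] by (auto simp: star_triples_def triples_def)
        then show ?thesis
          using 4 by (simp add: Y r1 mem)
      qed
    qed
  next
    fix Y :: "('v option \<Rightarrow> 'k) set"
    assume "Y \<in> cone_of_triples ?V ?R'"
    then consider "Y = hyp_at_infinity ?V" | a b c where "(a, b, c) \<in> ?R'" "Y = cone_hyp ?V a b c"
      by (auto simp: cone_of_triples_def)
    then show "Y \<in> restr_hyp ` cone_of_triples V ?R"
    proof cases
      case 1
      then show ?thesis unfolding cone_of_triples_def by (simp add: r_inf[symmetric])
    next
      case (2 a b c)
      have mem: "restr_hyp (cone_hyp V a' b' c') \<in> restr_hyp ` cone_of_triples V ?R" if "(a', b', c') \<in> ?R" for a' b' c'
        using that by (force simp: cone_of_triples_def)
      have ne: "a \<noteq> i" "b \<noteq> i"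
        using 2(1) V by (auto simp: star_triples_def triples_def)
      show ?thesis
      \<comment> \<open>The merged interval is cut at \<open>m\<close>: constants from
        \<open>m\<close> to \<open>n i + m\<close> come from the hyperplanes between
        \<open>a\<close> and \<open>i\<close>, and those up to \<open>m - 1\<close> from the
        hyperplanes between \<open>a\<close> and \<open>v\<close>, where \<open>u a\<close> is at
        least \<open>m - 1\<close>.\<close>
      proof (cases "b = v \<and> int m \<le> c")
        case True
        then have "(a, i, c - int m) \<in> ?R"
          using 2(1) V by (auto simp: star_triples_def triples_def)
        then show ?thesis
          using mem[of a i "c - int m"] r3[OF ne(1)] True by (simp add: 2(2))
      next
        case False
        then have "(a, b, c) \<in> ?R"
          using 2(1) V u(2)[of a] by (auto simp: star_triples_def triples_def)
        then show ?thesis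
          using mem[of a b c] r1[OF ne] by (simp add: 2(2))
      qed
    qed
  qed
  also have "?R' = star_triples ?W (n(v := n i + m)) v (\<lambda>_. int (n i + m))"
    by (rule star_triples_cong) auto
  also have "cone_of_triples ?V \<dots> = (cone_of_triples ?V (triples ?W (n(v := n i + m))) :: ('v option \<Rightarrow> 'k) set set)"
    using V by (intro cone_of_star_triples) auto
  finally have restr_eq: "restr_hyp ` cone_of_triples V ?R = cone_of_triples ?V (triples ?W (n(v := n i + m)))" .
  have "star_triples W n v (u(i := int m)) = insert (i, v, int m) ?R"
    using V u(1) by (auto simp: star_triples_def split: if_splits)
  then have insert: "cone_of_triples V (star_triples W n v (u(i := int m))) = insert H (cone_of_triples V ?R)"
    by (simp add: cone_of_triples_def H insert_commute)
  have "H \<notin> cone_of_triples V ?R"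
    unfolding H using V u(1) by (intro cone_hyp_notin_star) auto
  then show ?thesis
    unfolding insert using A A'' by (intro ind_free_exp_insert) (simp_all add: restr_eq J)
qed

text \<open>\<open>r\<close> counts inactive vertices, each a free coordinate of exponent 0;
  \<open>w\<close> counts active ones and \<open>N\<close> is the total of their parameters. The
  pair 0, 1 belongs to the common translation of all x_i and to the Euler derivation.\<close>

definition cone_exps :: "nat \<Rightarrow> nat \<Rightarrow> nat \<Rightarrow> nat multiset" where
  "cone_exps r N w = replicate_mset r 0 + {#0, 1#} + image_mset (\<lambda>k. N + k) (mset_set {1..w - 1})"

lemma cone_exps_Suc: "w \<ge> 1 \<Longrightarrow> cone_exps r N (Suc w) = cone_exps r N w + {#N + w#}"
proof -
  assume "w \<ge> 1"
  then have "{1..w} = insert w {1..w - 1}" by auto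
  then show ?thesis using \<open>w \<ge> 1\<close> by (simp add: cone_exps_def)
qed

text \<open>Isolates the exponent that grows when the total rises from \<open>N\<close> to
  \<open>Suc N\<close>: what remains are the exponents of the restrictions, which have one vertex
  less and already the new total. \<open>cone_exps_Suc\<close> reassembles the exponents after the
  last addition.\<close>

lemma cone_exps_shift: "w \<ge> 1 \<Longrightarrow> cone_exps r N (Suc w) = cone_exps r (Suc N) w + {#Suc N#}"
proof (induction w rule: dec_induct)
  case base
  then show ?case by (simp add: cone_exps_def)
next
  case (step w)
  then show ?case by (simp add: cone_exps_Suc)
qed

section \<open>The chain of additions and the induction on vertices and parameters\<close>

lemma ind_free_exp_star_chain:
  fixes V :: "'v set" and m :: nat
  assumes V: "finite V" "W \<subseteq> V" "v \<in> W" and S: "finite S" "S \<subseteq> W - {v}"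
    and start: "ind_free_exp (cone_index V)
      (cone_of_triples V (star_triples W n v (\<lambda>_. int m - 1)) :: ('v option \<Rightarrow> 'k::field_char_0) set set) (E' + {#d#})"
    and A'': "\<And>i. i \<in> W - {v} \<Longrightarrow> ind_free_exp (cone_index (V - {i}))
      (cone_of_triples (V - {i}) (triples (W - {i}) (n(v := n i + m))) :: ('v option \<Rightarrow> 'k) set set) E'"
  shows "ind_free_exp (cone_index V)
      (cone_of_triples V (star_triples W n v (\<lambda>j. if j \<in> S then int m else int m - 1)) :: ('v option \<Rightarrow> 'k) set set)
      (E' + {#d + card S#})"
  using S
proof (induction S rule: finite_induct)
  case empty
  then show ?case using start by simp
next
  case (insert i S)
  let ?u = "\<lambda>j. if j \<in> S then int m else int m - 1"
  have "ind_free_exp (cone_index V)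
      (cone_of_triples V (star_triples W n v (?u(i := int m))) :: ('v option \<Rightarrow> 'k) set set) (E' + {#Suc (d + card S)#})"
    using insert V by (intro ind_free_exp_star_step A'') auto
  moreover have "?u(i := int m) = (\<lambda>j. if j \<in> insert i S then int m else int m - 1)"
    by auto
  ultimately show ?case using insert.hyps by simp
qed

text \<open>Only the hyperplane at infinity is left: \<open>elimination\<close> is used with the
  eliminated coordinate z and zero coefficients. \<open>N\<close> is arbitrary because the range
  \<open>{1..0}\<close> is empty.\<close>

lemma ind_free_exp_single_vertex:
  assumes "finite V" "v \<in> V"
  shows "ind_free_exp (cone_index V) (cone_of_triples V (triples {v} n) :: ('v option \<Rightarrow> 'k::field_char_0) set set)
    (cone_exps (card V - 1) N 1)"
proof -
  interpret elimination "cone_index V" None "\<lambda>_. 0 :: 'k"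
    using assms by unfold_locales (auto simp: cone_index_def)
  have J: "J = Some ` V"
    unfolding J_def unfolding cone_index_def by auto
  have card: "card J = card V" "card (cone_index V) = Suc (card V)"
    using assms unfolding J by (simp_all add: cone_index_def card_image)
  have "ind_free_exp (cone_index V) (insert H {}) (replicate_mset (card V) 0 + {#Suc 0#})"
    using ind_free_exp_empty[OF finJ, where 'k = 'k] ind_free_exp_empty[OF fin, where 'k = 'k]
    by (intro ind_free_exp_insert) (simp_all add: card)
  moreover have "H = hyp_at_infinity V"
    by (auto simp: set_eq_iff mem_H hyp_at_infinity_def)
  moreover have "triples {v} n = {}"
    by (auto simp: triples_def)
  moreover have "replicate_mset (card V) 0 + {#Suc 0#} = cone_exps (card V - 1) N 1"
  proof -
    have "card V = Suc (card V - 1)"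
      using assms card_gt_0_iff[of V] by auto
    then have "replicate_mset (card V) (0 :: nat) = add_mset 0 (replicate_mset (card V - 1) 0)"
      by (metis replicate_mset_Suc)
    then show ?thesis by (simp add: cone_exps_def)
  qed
  ultimately show ?thesis by (simp add: cone_of_triples_def)
qed

text \<open>\<open>V\<close> and \<open>W\<close> vary separately: a restriction removes a vertex
  from both, whereas introducing a vertex starts from a smaller \<open>W\<close> in the same
  \<open>V\<close>.\<close>

lemma ind_free_exp_triples:
  fixes V W :: "'v set"
  assumes "finite V" "W \<subseteq> V" "W \<noteq> {}"
  shows "ind_free_exp (cone_index V) (cone_of_triples V (triples W n) :: ('v option \<Rightarrow> 'k::field_char_0) set set)
    (cone_exps (card V - card W) (sum n W) (card W))"
  using assms
proof (induction "card W" arbitrary: V W n rule: less_induct)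
  case (less W V n)
  note outer = less.hyps
  have finW: "finite W" using less.prems finite_subset by blast
  show ?case
  proof (cases "card W = 1")
    case True
    then obtain v where "W = {v}" by (auto simp: card_1_singleton_iff)
    then show ?thesis using ind_free_exp_single_vertex[of V v n] less.prems by simp
  next
    case False
    define w where "w = card W - 1"
    have w: "card W = Suc w" "w \<ge> 1"
      using False less.prems finW card_gt_0_iff[of W] by (auto simp: w_def)
    text \<open>Passing from \<open>n\<^sub>v = m - 1\<close> to \<open>n\<^sub>v = m\<close>; here \<open>m = 0\<close> means that \<open>v\<close> starts out inactive.\<close>
    have raise: "ind_free_exp (cone_index V) (cone_of_triples V (triples W (n(v := m))) :: ('v option \<Rightarrow> 'k) set set)
        (cone_exps (card V - card W) (sum n (W - {v}) + m) (card W))"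
      if v: "v \<in> W"
        and start: "ind_free_exp (cone_index V)
          (cone_of_triples V (star_triples W n v (\<lambda>_. int m - 1)) :: ('v option \<Rightarrow> 'k) set set)
          (cone_exps (card V - card W) (sum n (W - {v}) + m) w + {#sum n (W - {v}) + m#})" for v m and n :: "'v \<Rightarrow> nat"
    proof -
      have "ind_free_exp (cone_index (V - {i}))
          (cone_of_triples (V - {i}) (triples (W - {i}) (n(v := n i + m))) :: ('v option \<Rightarrow> 'k) set set)
          (cone_exps (card V - card W) (sum n (W - {v}) + m) w)" if i: "i \<in> W - {v}" for i
      proof -
        have "i \<in> V" using i less.prems by blast
        \<comment> \<open>Gluing adds the parameter of \<open>i\<close> to that of \<open>v\<close>,
          so the total of the restriction is the same for every \<open>i\<close>.\<close>
        have "sum (n(v := n i + m)) (W - {i}) = (n i + m) + sum (n(v := n i + m)) (W - {i} - {v})"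
          using i v finW by (subst sum.remove[of _ v]) auto
        also have "sum (n(v := n i + m)) (W - {i} - {v}) = sum n (W - {v} - {i})"
          by (intro sum.cong) auto
        also have "n i + m + sum n (W - {v} - {i}) = sum n (W - {v}) + m"
          using i finW by (subst sum.remove[of "W - {v}" i]) auto
        finally have "sum (n(v := n i + m)) (W - {i}) = sum n (W - {v}) + m" .
        moreover have "card (W - {i}) = w" "card (V - {i}) - w = card V - card W"
          using i w finW less.prems \<open>i \<in> V\<close> by auto
        moreover have "ind_free_exp (cone_index (V - {i}))
            (cone_of_triples (V - {i}) (triples (W - {i}) (n(v := n i + m))) :: ('v option \<Rightarrow> 'k) set set)
            (cone_exps (card (V - {i}) - card (W - {i})) (sum (n(v := n i + m)) (W - {i})) (card (W - {i})))"
          using i v w finW less.prems by (intro outer) auto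
        ultimately show ?thesis by simp
      qed
      from ind_free_exp_star_chain[OF less.prems(1,2) v _ order_refl start this]
      have "ind_free_exp (cone_index V)
          (cone_of_triples V (star_triples W n v (\<lambda>j. if j \<in> W - {v} then int m else int m - 1)) :: ('v option \<Rightarrow> 'k) set set)
          (cone_exps (card V - card W) (sum n (W - {v}) + m) w + {#sum n (W - {v}) + m + card (W - {v})#})"
        using finW by simp
      moreover have "card (W - {v}) = w" using v w finW by simp
      moreover have "star_triples W n v (\<lambda>j. if j \<in> W - {v} then int m else int m - 1) =
          star_triples W (n(v := m)) v (\<lambda>_. int m)"
        by (intro star_triples_cong) auto
      moreover have "cone_of_triples V (star_triples W (n(v := m)) v (\<lambda>_. int m)) =
          (cone_of_triples V (triples W (n(v := m))) :: ('v option \<Rightarrow> 'k) set set)"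
        using v by (intro cone_of_star_triples) auto
      ultimately show ?thesis
        by (simp add: w(1) cone_exps_Suc[OF w(2)])
    qed
    show ?thesis
    proof (induction "sum n W" arbitrary: n rule: less_induct)
      case (less n)
      show ?case
      proof (cases "\<forall>v\<in>W. n v = 0")
        case True
        obtain v where v: "v \<in> W" using \<open>W \<noteq> {}\<close> by blast
        have sum0: "sum n W = 0" "sum n (W - {v}) = 0" using True by simp_all
        \<comment> \<open>All parameters vanish, so the constants between \<open>j\<close> and
          \<open>v\<close> run from 0 to -1 and \<open>v\<close> meets no hyperplane.\<close>
        have "star_triples W n v (\<lambda>_. int 0 - 1) = triples (W - {v}) n"
          using True by (auto simp: star_triples_def)
        \<comment> \<open>The inactive \<open>v\<close> supplies the exponent 0 that the additions
          will raise.\<close>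
        moreover have "cone_exps (card V - card (W - {v})) 0 w = cone_exps (card V - card W) 0 w + {#0#}"
        proof -
          have "card W \<le> card V" using \<open>finite V\<close> \<open>W \<subseteq> V\<close> by (rule card_mono)
          then have "card V - card (W - {v}) = Suc (card V - card W)"
            using v w finW by simp
          then show ?thesis by (simp add: cone_exps_def)
        qed
        moreover have "ind_free_exp (cone_index V) (cone_of_triples V (triples (W - {v}) n) :: ('v option \<Rightarrow> 'k) set set)
            (cone_exps (card V - card (W - {v})) (sum n (W - {v})) (card (W - {v})))"
        proof (rule outer)
          have "card (W - {v}) = w" using v w finW by simp
          then show "card (W - {v}) < card W" "W - {v} \<noteq> {}"
            using w by (simp, metis card.empty not_one_le_zero)
        qed (use \<open>finite V\<close> \<open>W \<subseteq> V\<close> in auto)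
        ultimately have "ind_free_exp (cone_index V) (cone_of_triples V (triples W (n(v := 0))) :: ('v option \<Rightarrow> 'k) set set)
            (cone_exps (card V - card W) (sum n (W - {v}) + 0) (card W))"
          using v w finW sum0 by (intro raise) simp_all
        moreover have "n(v := 0) = n" using True v by auto
        ultimately show ?thesis by (simp add: sum0)
      next
        case False
        then obtain v m where v: "v \<in> W" "n v = Suc m"
          using not0_implies_Suc by blast
        have sum_n: "sum n W = sum n (W - {v}) + Suc m"
          using v finW by (simp add: sum.remove)
        have sum_n': "sum (n(v := m)) W = sum n (W - {v}) + m"
        proof -
          have "sum (n(v := m)) (W - {v}) = sum n (W - {v})" by (intro sum.cong) auto
          then show ?thesis using v finW by (simp add: sum.remove)
        qed
        \<comment> \<open>Lowering the upper bounds at \<open>v\<close> by one is the same as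
          lowering its parameter, since the lower bounds depend only on the other vertices.\<close>
        have "star_triples W n v (\<lambda>_. int (Suc m) - 1) = star_triples W (n(v := m)) v (\<lambda>_. int m)"
          by (intro star_triples_cong) auto
        moreover have "cone_of_triples V (star_triples W (n(v := m)) v (\<lambda>_. int m)) =
            (cone_of_triples V (triples W (n(v := m))) :: ('v option \<Rightarrow> 'k) set set)"
          using v by (intro cone_of_star_triples) auto
        moreover have "ind_free_exp (cone_index V) (cone_of_triples V (triples W (n(v := m))) :: ('v option \<Rightarrow> 'k) set set)
            (cone_exps (card V - card W) (sum n (W - {v}) + m) (card W))"
          unfolding sum_n'[symmetric] by (rule less) (unfold sum_n sum_n', simp)
        ultimately have "ind_free_exp (cone_index V) (cone_of_triples V (triples W (n(v := Suc m))) :: ('v option \<Rightarrow> 'k) set set)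
            (cone_exps (card V - card W) (sum n (W - {v}) + Suc m) (card W))"
          using v by (intro raise) (simp_all add: w(1) cone_exps_shift[OF w(2)])
        moreover have "n(v := Suc m) = n" using v by auto
        ultimately show ?thesis by (simp add: sum_n)
      qed
    qed
  qed
qed

text \<open>The cone is defined through membership of an affine hyperplane as a set, which could
  hold by way of another triple. The only other candidate is the reversed one, and without edges the
  bounds on \<open>c\<close> are invariant under reversal.\<close>

lemma cone_arrangement_no_edges:
  "(cone_arrangement V {} n :: ('v option \<Rightarrow> 'k::field_char_0) set set) = cone_of_triples V (triples V n)"
proof -
  have mem1: "(i, j, c) \<in> triples V n"
    if ij: "i \<in> V" "j \<in> V" "i \<noteq> j" and mem: "(affine_hyp V i j c :: ('v \<Rightarrow> 'k) set) \<in> digraph_arrangement V {} n" for i j c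
  proof -
    obtain i' j' c' where *: "(affine_hyp V i j c :: ('v \<Rightarrow> 'k) set) = affine_hyp V i' j' c'"
      "i' \<in> V" "j' \<in> V" "i' \<noteq> j'" "- int (n i') \<le> c'" "c' \<le> int (n j')"
      using mem by (auto simp: digraph_arrangement_def edge_ind_def)
    from affine_hyp_eqD[OF *(1) ij(1,2) *(2,3) ij(3) *(4)] *(5,6) ij show ?thesis
      by (auto simp: triples_def)
  qed
  have mem2: "(affine_hyp V i j c :: ('v \<Rightarrow> 'k) set) \<in> digraph_arrangement V {} n" if "(i, j, c) \<in> triples V n" for i j c
    using that unfolding digraph_arrangement_def triples_def edge_ind_def by auto
  have iff: "i \<in> V \<and> j \<in> V \<and> i \<noteq> j \<and> (affine_hyp V i j c :: ('v \<Rightarrow> 'k) set) \<in> digraph_arrangement V {} n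
      \<longleftrightarrow> (i, j, c) \<in> triples V n" for i j c
    using mem1[of i j c] mem2[of i j c] by (auto simp: triples_def)
  have "{cone_hyp V i j c :: ('v option \<Rightarrow> 'k) set | i j c. (i, j, c) \<in> R} = (\<lambda>(i, j, c). cone_hyp V i j c) ` R" for R
    by force
  then show ?thesis
    unfolding cone_arrangement_def iff cone_of_triples_def by simp
qed

theorem theorem2p9:
  fixes V :: "'v set" and n :: "'v \<Rightarrow> nat" and l :: nat
    and A :: "('v option \<Rightarrow> 'k::field_char_0) set set"
  assumes "finite V" and "card V = l" and "l \<ge> 2"
    and "A = cone_arrangement V {} n"
  shows "free_arrangement (cone_index V) A \<and>
         has_exponents (cone_index V) A
           ({#0, 1#} + image_mset (\<lambda>k. (\<Sum>i\<in>V. n i) + k) (mset_set {1..l - 1})) \<and>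
         inductively_free (cone_index V) A"
proof -
  have "V \<noteq> {}" using assms(2,3) by auto
  \<comment> \<open>All vertices are active, so no extra zeros remain.\<close>
  then have "ind_free_exp (cone_index V) A (cone_exps (card V - card V) (sum n V) (card V))"
    unfolding assms(4) cone_arrangement_no_edges by (intro ind_free_exp_triples assms(1)) auto
  then show ?thesis
    using assms(2) by (auto simp: ind_free_exp_def cone_exps_def has_exponents_def free_arrangement_def)
qed

end
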